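(* Let $n\geq1$ and let $\Delta=\{\lambda_j:j\in\mathbb{N}\}\subseteq\mathbb{B}_n$, where $\mathbb{B}_n$ is the open unit ball of $\mathbb{C}^n$. If $\sum_{j=0}^\infty\left(1-\|\lambda_j\|_{\mathbb{C}^n}\right)<\infty$, then the weak* spectrum $\Sigma(F^\infty_{n,\Delta})$ of $F^\infty_{n,\Delta}=F_n^\infty/\mathcal{N}_\Delta$ is $\Delta$.
   Context: The full Fock space $F_n^2=\bigoplus_{k\geq 0}(\mathbb{C}^n)^{\otimes k}$ (Hilbert space direct sum, $(\mathbb{C}^n)^{\otimes 0}=\mathbb{C}1$) carries the left creation operators $S_j\xi=e_j\otimes\xi$, $S_j(1)=e_j$, $j=1,\dots,n$, where $(e_j)$ is the canonical basis of $\mathbb{C}^n$. The noncommutative Hardy algebra $F_n^\infty$ is the weak-operator closure of the algebra generated by $1,S_1,\dots,S_n$ in the bounded operators on $F_n^2$. It is a dual space, whose weak* topology is the restriction of the weak operator topology. For each $\lambda\in\mathbb{B}_n$ there is a unique weak* continuous unital algebra homomorphism $\pi_\lambda:F_n^\infty\to\mathbb{C}$ with $\pi_\lambda(S_j)=\lambda_j$ for all $j$, and every weak* continuous unital homomorphism $F_n^\infty\to\mathbb{C}$ is of this form; one writes $\varphi(\lambda)=\pi_\lambda(\varphi)$. For $\Delta\subseteq\mathbb{B}_n$, $\mathcal{N}_\Delta=\{\varphi\in F_n^\infty:\varphi(z)=0\ \forall z\in\Delta\}$, a weak* closed two-sided ideal, and $F_{n,\Delta}^\infty=F_n^\infty/\mathcal{N}_\Delta$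 with the quotient weak* topology (as the dual of the pre-annihilator of $\mathcal{N}_\Delta$). The spectrum $\Sigma(F^\infty_{n,\Delta})$ is the set of weak* continuous unital algebra homomorphisms $F_{n,\Delta}^\infty\to\mathbb{C}$ (with the weak* topology of the dual of $F_{n,\Delta}^\infty$). It is identified with a subset of $\mathbb{B}_n$ by composing with the quotient map $F_n^\infty\to F_{n,\Delta}^\infty$ and identifying $\pi_\lambda$ with $\lambda$; under this identification $\Sigma(F^\infty_{n,\Delta})=\{z\in\mathbb{B}_n:\forall\varphi\in\mathcal{N}_\Delta\ \ \varphi(z)=0\}$. *)

theory Defs
  imports
    "HOL-Analysis.Analysis"
    "HOL-Algebra.QuotRing"
    "HOL-Algebra.Module"
    "HOL-Algebra.Algebraic_Closure_Type"
begin

section \<open>The full Fock space\<close>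

text \<open>
  The index set of the canonical basis of \<open>\<complex>\<^sup>n\<close> is a finite type \<open>'n\<close>. The vectors
  \<open>e\<^sub>i\<^sub>1 \<otimes> \<dots> \<otimes> e\<^sub>i\<^sub>k\<close>, indexed by the words of length \<open>k\<close>, form an orthonormal basis of
  \<open>(\<complex>\<^sup>n)\<^sup>\<otimes>\<^sup>k\<close>, so the Hilbert space direct sum over all \<open>k\<close> consists of the square-summable
  families of coefficients on words; the empty word corresponds to the vacuum vector \<open>1\<close>.
\<close>

typedef 'n fock = "{f :: 'n list \<Rightarrow> complex. (\<lambda>w. (cmod (f w))\<^sup>2) summable_on UNIV}"
  morphisms coeff_fock Abs_fock
  by (rule exI[of _ "\<lambda>_. 0"]) simp

setup_lifting type_definition_fock

lemma square_summable_mult: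
  fixes f g :: "'a \<Rightarrow> complex"
  assumes "(\<lambda>w. (cmod (f w))\<^sup>2) summable_on A" "(\<lambda>w. (cmod (g w))\<^sup>2) summable_on A"
  shows "(\<lambda>w. norm (f w * g w)) summable_on A"
  by (rule abs_summable_product) (use assms in \<open>simp_all add: norm_mult power2_eq_square\<close>)

lemma square_summable_add:
  fixes f g :: "'a \<Rightarrow> complex"
  assumes "(\<lambda>w. (cmod (f w))\<^sup>2) summable_on A" "(\<lambda>w. (cmod (g w))\<^sup>2) summable_on A"
  shows "(\<lambda>w. (cmod (f w + g w))\<^sup>2) summable_on A"
proof (rule summable_on_comparison_test)
  show "(\<lambda>w. 2 * (cmod (f w))\<^sup>2 + 2 * (cmod (g w))\<^sup>2) summable_on A"
    by (intro summable_on_add summable_on_cmult_right assms)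
  show "(cmod (f w + g w))\<^sup>2 \<le> 2 * (cmod (f w))\<^sup>2 + 2 * (cmod (g w))\<^sup>2" for w
  proof -
    have "(cmod (f w + g w))\<^sup>2 \<le> (cmod (f w) + cmod (g w))\<^sup>2"
      by (intro power_mono norm_triangle_ineq) simp
    also have "\<dots> \<le> 2 * (cmod (f w))\<^sup>2 + 2 * (cmod (g w))\<^sup>2"
      using sum_squares_bound[of "cmod (f w)" "cmod (g w)"] by (simp add: power2_sum)
    finally show ?thesis .
  qed
qed simp

lemma square_summable_scale:
  fixes f :: "'a \<Rightarrow> complex"
  assumes "(\<lambda>w. (cmod (f w))\<^sup>2) summable_on A"
  shows "(\<lambda>w. (cmod (c * f w))\<^sup>2) summable_on A"
  using summable_on_cmult_right[OF assms, of "(cmod c)\<^sup>2"]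
  by (simp add: norm_mult power_mult_distrib)

lift_definition cscale_fock :: "complex \<Rightarrow> 'n fock \<Rightarrow> 'n fock"
  is "\<lambda>c f w. c * f w"
  by (rule square_summable_scale)

definition cinner_fock :: "'n fock \<Rightarrow> 'n fock \<Rightarrow> complex"
  where "cinner_fock \<xi> \<eta> = (\<Sum>\<^sub>\<infinity>w. coeff_fock \<xi> w * cnj (coeff_fock \<eta> w))"

lemma square_summable_coeff: "(\<lambda>w. (cmod (coeff_fock \<xi> w))\<^sup>2) summable_on UNIV"
  using coeff_fock[of \<xi>] by simp

lemma summable_cinner_fock:
  "(\<lambda>w. coeff_fock \<xi> w * cnj (coeff_fock \<eta> w)) summable_on UNIV"
  by (rule abs_summable_summable, rule square_summable_mult)
     (simp_all add: square_summable_coeff)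

instantiation fock :: (type) real_vector
begin

lift_definition zero_fock :: "'a fock" is "\<lambda>_. 0" by simp

lift_definition plus_fock :: "'a fock \<Rightarrow> 'a fock \<Rightarrow> 'a fock" is "\<lambda>f g w. f w + g w"
  by (rule square_summable_add)

lift_definition uminus_fock :: "'a fock \<Rightarrow> 'a fock" is "\<lambda>f w. - f w" by simp

lift_definition minus_fock :: "'a fock \<Rightarrow> 'a fock \<Rightarrow> 'a fock" is "\<lambda>f g w. f w - g w"
  subgoal for f g using square_summable_add[of f UNIV "\<lambda>w. - g w"] by simp
  done

lift_definition scaleR_fock :: "real \<Rightarrow> 'a fock \<Rightarrow> 'a fock" is "\<lambda>r f w. complex_of_real r * f w"
  by (rule square_summable_scale)

instance
  by standard (transfer; simp add: algebra_simps fun_eq_iff)+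

end

lemma Re_cinner_fock_self: "Re (cinner_fock \<xi> \<xi>) = (\<Sum>\<^sub>\<infinity>w. (cmod (coeff_fock \<xi> w))\<^sup>2)"
  unfolding cinner_fock_def infsum_Re[OF summable_cinner_fock, symmetric]
  by (rule infsum_cong) (simp only: complex_mult_cnj cmod_power2 Re_complex_of_real)

instantiation fock :: (type) real_inner
begin

definition inner_fock :: "'a fock \<Rightarrow> 'a fock \<Rightarrow> real"
  where "inner_fock \<xi> \<eta> = Re (cinner_fock \<xi> \<eta>)"

definition norm_fock :: "'a fock \<Rightarrow> real"
  where "norm_fock \<xi> = sqrt (inner \<xi> \<xi>)"

definition sgn_fock :: "'a fock \<Rightarrow> 'a fock"
  where "sgn_fock \<xi> = inverse (norm \<xi>) *\<^sub>R \<xi>"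

definition dist_fock :: "'a fock \<Rightarrow> 'a fock \<Rightarrow> real"
  where "dist_fock \<xi> \<eta> = norm (\<xi> - \<eta>)"

definition uniformity_fock :: "('a fock \<times> 'a fock) filter"
  where "uniformity_fock = (INF e\<in>{0<..}. principal {(\<xi>, \<eta>). dist \<xi> \<eta> < e})"

definition open_fock :: "'a fock set \<Rightarrow> bool"
  where "open_fock U \<longleftrightarrow> (\<forall>\<xi>\<in>U. eventually (\<lambda>(\<xi>', \<eta>). \<xi>' = \<xi> \<longrightarrow> \<eta> \<in> U) uniformity)"

instance
proof
  fix \<xi> \<eta> \<zeta> :: "'a fock" and r :: real
  have self: "inner \<xi> \<xi> = (\<Sum>\<^sub>\<infinity>w. (cmod (coeff_fock \<xi> w))\<^sup>2)"
    by (simp only: inner_fock_def Re_cinner_fock_self)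
  have "cinner_fock \<eta> \<xi> = cnj (cinner_fock \<xi> \<eta>)"
    unfolding cinner_fock_def infsum_cnj[symmetric] by (simp add: mult.commute)
  then show "inner \<xi> \<eta> = inner \<eta> \<xi>"
    by (simp add: inner_fock_def)
  show "inner (\<xi> + \<eta>) \<zeta> = inner \<xi> \<zeta> + inner \<eta> \<zeta>"
    by (simp add: inner_fock_def cinner_fock_def plus_fock.rep_eq distrib_right
        infsum_add[OF summable_cinner_fock summable_cinner_fock])
  show "inner (r *\<^sub>R \<xi>) \<eta> = r * inner \<xi> \<eta>"
    by (simp add: inner_fock_def cinner_fock_def scaleR_fock.rep_eq mult.assoc
        infsum_cmult_right[OF summable_cinner_fock])
  show "0 \<le> inner \<xi> \<xi>"
    unfolding self by (rule infsum_nonneg) simp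
  show "inner \<xi> \<xi> = 0 \<longleftrightarrow> \<xi> = 0"
  proof
    assume "inner \<xi> \<xi> = 0"
    then have "(\<Sum>\<^sub>\<infinity>w. (cmod (coeff_fock \<xi> w))\<^sup>2) \<le> 0"
      by (simp add: self)
    from nonneg_infsum_le_0D[OF this square_summable_coeff]
    have "coeff_fock \<xi> w = 0" for w by simp
    then show "\<xi> = 0"
      by (intro coeff_fock_inject[THEN iffD1]) (simp add: zero_fock.rep_eq fun_eq_iff)
  next
    assume "\<xi> = 0"
    then show "inner \<xi> \<xi> = 0" unfolding self by (simp add: zero_fock.rep_eq)
  qed
qed (simp_all add: norm_fock_def sgn_fock_def dist_fock_def uniformity_fock_def open_fock_def)

end

lemma norm_fock_square: "(norm \<xi>)\<^sup>2 = (\<Sum>\<^sub>\<infinity>w. (cmod (coeff_fock \<xi> w))\<^sup>2)"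
  by (simp only: power2_norm_eq_inner inner_fock_def Re_cinner_fock_self)

lemma norm_cscale_fock: "norm (cscale_fock c \<xi>) = cmod c * norm \<xi>"
proof -
  have "(norm (cscale_fock c \<xi>))\<^sup>2 = (cmod c * norm \<xi>)\<^sup>2"
    by (simp add: norm_fock_square cscale_fock.rep_eq norm_mult power_mult_distrib
        infsum_cmult_right square_summable_coeff)
  then show ?thesis by (simp add: power2_eq_iff_nonneg)
qed


section \<open>Bounded operators and the weak operator topology\<close>

text \<open>
  Library bounded operators (type \<open>\<Rightarrow>\<^sub>L\<close>) are only real-linear, so complex homogeneity is imposed.
\<close>

definition fock_ops :: "('n fock \<Rightarrow>\<^sub>L 'n fock) set"
  where "fock_ops = {T. \<forall>c \<xi>. blinfun_apply T (cscale_fock c \<xi>) = cscale_fock c (blinfun_apply T \<xi>)}"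

lemma bounded_linear_cscale_fock: "bounded_linear (cscale_fock c)"
proof (rule bounded_linear_intro)
  show "norm (cscale_fock c \<xi>) \<le> norm \<xi> * cmod c" for \<xi> :: "'n fock"
    by (simp add: norm_cscale_fock)
qed (transfer; simp add: algebra_simps fun_eq_iff)+

definition cscale_op :: "complex \<Rightarrow> ('n fock \<Rightarrow>\<^sub>L 'n fock) \<Rightarrow> ('n fock \<Rightarrow>\<^sub>L 'n fock)"
  where "cscale_op c T = Blinfun (cscale_fock c) o\<^sub>L T"

lemma cscale_op_apply [simp]:
  "blinfun_apply (cscale_op c T) \<xi> = cscale_fock c (blinfun_apply T \<xi>)"
  by (simp add: cscale_op_def bounded_linear_Blinfun_apply[OF bounded_linear_cscale_fock])

definition wot :: "('n fock \<Rightarrow>\<^sub>L 'n fock) topology"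
  where "wot = topology_generated_by
    {{T \<in> fock_ops. cinner_fock (blinfun_apply T \<xi>) \<eta> \<in> U} | \<xi> \<eta> U. open U}"

fun shift_word :: "'n \<Rightarrow> ('n list \<Rightarrow> complex) \<Rightarrow> 'n list \<Rightarrow> complex"
  where
    "shift_word i f [] = 0"
  | "shift_word i f (j # w) = (if j = i then f w else 0)"

lemma shift_word_square_summable:
  assumes "(\<lambda>w. (cmod (f w))\<^sup>2) summable_on UNIV"
  shows "(\<lambda>w. (cmod (shift_word i f w))\<^sup>2) summable_on UNIV"
    and "(\<Sum>\<^sub>\<infinity>w. (cmod (shift_word i f w))\<^sup>2) = (\<Sum>\<^sub>\<infinity>w. (cmod (f w))\<^sup>2)"
proof -
  let ?g = "\<lambda>w. (cmod (shift_word i f w))\<^sup>2"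
  have comp: "?g \<circ> (#) i = (\<lambda>w. (cmod (f w))\<^sup>2)" by auto
  have zero: "?g w = 0" if "w \<notin> range ((#) i)" for w
    using that by (cases w) auto
  have "?g summable_on range ((#) i)"
    by (subst summable_on_reindex) (use assms comp in auto)
  then show "?g summable_on UNIV"
    using zero by (subst summable_on_cong_neutral[where g = ?g and T = "range ((#) i)"]) auto
  have "infsum ?g UNIV = infsum ?g (range ((#) i))"
    using zero by (intro infsum_cong_neutral) auto
  also have "\<dots> = (\<Sum>\<^sub>\<infinity>w. (cmod (f w))\<^sup>2)"
    by (subst infsum_reindex) (use comp in auto)
  finally show "infsum ?g UNIV = (\<Sum>\<^sub>\<infinity>w. (cmod (f w))\<^sup>2)" .
qed

lift_definition creation_fun :: "'n \<Rightarrow> 'n fock \<Rightarrow> 'n fock" is shift_word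
  by (rule shift_word_square_summable)

text \<open>The left creation operator \<open>S\<^sub>i \<xi> = e\<^sub>i \<otimes> \<xi>\<close>: it prefixes every word with the letter \<open>i\<close>.\<close>

definition creation :: "'n \<Rightarrow> ('n fock \<Rightarrow>\<^sub>L 'n fock)"
  where "creation i = Blinfun (creation_fun i)"

lemma bounded_linear_creation_fun: "bounded_linear (creation_fun (i :: 'a))"
proof (rule bounded_linear_intro[where K = 1])
  fix \<xi> \<eta> :: "'a fock" and r :: real
  show "creation_fun i (\<xi> + \<eta>) = creation_fun i \<xi> + creation_fun i \<eta>"
  proof (transfer, rule ext)
    fix i :: 'a and f g :: "'a list \<Rightarrow> complex" and w
    show "shift_word i (\<lambda>w. f w + g w) w = shift_word i f w + shift_word i g w"
      by (cases w) auto
  qed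
  show "creation_fun i (r *\<^sub>R \<xi>) = r *\<^sub>R creation_fun i \<xi>"
  proof (transfer, rule ext)
    fix i :: 'a and f :: "'a list \<Rightarrow> complex" and r w
    show "shift_word i (\<lambda>w. complex_of_real r * f w) w = complex_of_real r * shift_word i f w"
      by (cases w) auto
  qed
  have "(norm (creation_fun i \<xi>))\<^sup>2 = (norm \<xi>)\<^sup>2"
    by (simp add: norm_fock_square creation_fun.rep_eq
        shift_word_square_summable(2)[OF square_summable_coeff])
  then show "norm (creation_fun i \<xi>) \<le> norm \<xi> * 1"
    by (simp add: power2_eq_iff_nonneg)
qed

lemma creation_apply [simp]: "blinfun_apply (creation i) = creation_fun i"
  by (simp add: creation_def bounded_linear_Blinfun_apply[OF bounded_linear_creation_fun])

lemma creation_in_fock_ops: "creation i \<in> fock_ops"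
proof -
  have "shift_word i (\<lambda>w. c * f w) w = c * shift_word i f w" for c f w
    by (cases w) auto
  then have "creation_fun i (cscale_fock c \<xi>) = cscale_fock c (creation_fun i \<xi>)" for c \<xi>
    by (intro coeff_fock_inject[THEN iffD1])
       (simp add: creation_fun.rep_eq cscale_fock.rep_eq fun_eq_iff)
  then show ?thesis
    by (simp add: fock_ops_def)
qed


section \<open>The noncommutative Hardy algebra\<close>

inductive_set creation_algebra :: "('n fock \<Rightarrow>\<^sub>L 'n fock) set"
  where
    one: "id_blinfun \<in> creation_algebra"
  | creation: "creation i \<in> creation_algebra"
  | add: "S \<in> creation_algebra \<Longrightarrow> T \<in> creation_algebra \<Longrightarrow> S + T \<in> creation_algebra"
  | mult: "S \<in> creation_algebra \<Longrightarrow> T \<in> creation_algebra \<Longrightarrow> S o\<^sub>L T \<in> creation_algebra"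
  | scale: "S \<in> creation_algebra \<Longrightarrow> cscale_op c S \<in> creation_algebra"

definition hardy_set :: "('n fock \<Rightarrow>\<^sub>L 'n fock) set"
  where "hardy_set = wot closure_of creation_algebra"

definition hardy :: "(complex, 'n fock \<Rightarrow>\<^sub>L 'n fock) module"
  where "hardy = \<lparr>carrier = hardy_set, mult = (o\<^sub>L), one = id_blinfun,
    zero = 0, add = (+), smult = cscale_op\<rparr>"

text \<open>The weak* topology of this dual space is the restriction of the weak operator topology.\<close>

definition hardy_weakstar :: "('n fock \<Rightarrow>\<^sub>L 'n fock) topology"
  where "hardy_weakstar = subtopology wot hardy_set"


section \<open>Weak* continuous characters and point evaluations\<close>

text \<open>
  Weak* continuous unital algebra homomorphisms into \<open>\<complex>\<close>. Functions are total in HOL, so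
  characters are taken to be extensional on the carrier in order that equality of characters be
  equality on the algebra.
\<close>

definition characters :: "(complex, 'a) module \<Rightarrow> 'a topology \<Rightarrow> ('a \<Rightarrow> complex) set"
  where "characters A \<tau> = {\<psi> \<in> extensional (carrier A).
    \<psi> \<in> ring_hom A ring_of_type_algebra \<and>
    (\<forall>c. \<forall>a\<in>carrier A. \<psi> (c \<odot>\<^bsub>A\<^esub> a) = c * \<psi> a) \<and>
    continuous_map \<tau> euclidean \<psi>}"

text \<open>The evaluation \<open>\<pi>\<^sub>z\<close>; thus \<open>point_eval z \<phi>\<close> is \<open>\<phi>(z)\<close>.\<close>

definition point_eval :: "complex ^ 'n \<Rightarrow> ('n::finite fock \<Rightarrow>\<^sub>L 'n fock) \<Rightarrow> complex"
  where "point_eval z = (THE \<pi>. \<pi> \<in> characters hardy hardy_weakstar \<and> (\<forall>j. \<pi> (creation j) = z $ j))"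


section \<open>The quotient algebra and its spectrum\<close>

definition null_ideal :: "(complex ^ 'n) set \<Rightarrow> ('n::finite fock \<Rightarrow>\<^sub>L 'n fock) set"
  where "null_ideal \<Delta> = {\<phi> \<in> hardy_set. \<forall>z\<in>\<Delta>. point_eval z \<phi> = 0}"

text \<open>The library quotient ring, together with the induced scalar multiplication of cosets.\<close>

definition quotient_algebra :: "(complex, 'a) module \<Rightarrow> 'a set \<Rightarrow> (complex, 'a set) module"
  where "quotient_algebra A N = ring.extend (A Quot N)
    (module.fields (\<lambda>c C. \<Union>a\<in>C. N +>\<^bsub>A\<^esub> (c \<odot>\<^bsub>A\<^esub> a)))"

text \<open>
  The predual is represented by the weak* continuous linear functionals.
\<close>

definition hardy_predual :: "(('n fock \<Rightarrow>\<^sub>L 'n fock) \<Rightarrow> complex) set"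
  where "hardy_predual = {f.
    (\<forall>a\<in>hardy_set. \<forall>b\<in>hardy_set. f (a + b) = f a + f b) \<and>
    (\<forall>c. \<forall>a\<in>hardy_set. f (cscale_op c a) = c * f a) \<and>
    continuous_map hardy_weakstar euclidean f}"

definition preannihilator ::
  "('n fock \<Rightarrow>\<^sub>L 'n fock) set \<Rightarrow> (('n fock \<Rightarrow>\<^sub>L 'n fock) \<Rightarrow> complex) set"
  where "preannihilator N = {f \<in> hardy_predual. \<forall>a\<in>N. f a = 0}"

definition hardy_quotient :: "(complex ^ 'n) set \<Rightarrow> (complex, ('n::finite fock \<Rightarrow>\<^sub>L 'n fock) set) module"
  where "hardy_quotient \<Delta> = quotient_algebra hardy (null_ideal \<Delta>)"

text \<open>
  The weak* topology of the quotient as the dual of the pre-annihilator: the coarsest topology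
  for which every functional \<open>\<phi> + N \<mapsto> f \<phi>\<close>, with \<open>f\<close> in the pre-annihilator of the ideal \<open>N\<close>,
  is continuous. Each generating set below is the preimage of \<open>U\<close> under such a functional.
\<close>

definition hardy_quotient_weakstar ::
  "(complex ^ 'n) set \<Rightarrow> ('n::finite fock \<Rightarrow>\<^sub>L 'n fock) set topology"
  where "hardy_quotient_weakstar \<Delta> = topology_generated_by
    {(\<lambda>\<phi>. null_ideal \<Delta> +>\<^bsub>hardy\<^esub> \<phi>) ` {\<phi> \<in> hardy_set. f \<phi> \<in> U} | f U.
      f \<in> preannihilator (null_ideal \<Delta>) \<and> open U}"

definition weakstar_spectrum :: "(complex ^ 'n) set \<Rightarrow> (('n::finite fock \<Rightarrow>\<^sub>L 'n fock) set \<Rightarrow> complex) set"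
  where "weakstar_spectrum \<Delta> = characters (hardy_quotient \<Delta>) (hardy_quotient_weakstar \<Delta>)"

text \<open>
  The identification of the spectrum with a subset of the open unit ball: a character is sent to
  the point whose evaluation is its composition with the quotient map.
\<close>

definition spectrum_point ::
  "(complex ^ 'n) set \<Rightarrow> (('n::finite fock \<Rightarrow>\<^sub>L 'n fock) set \<Rightarrow> complex) \<Rightarrow> complex ^ 'n"
  where "spectrum_point \<Delta> \<psi> = (THE z. z \<in> ball 0 1 \<and>
    (\<forall>\<phi>\<in>hardy_set. \<psi> (null_ideal \<Delta> +>\<^bsub>hardy\<^esub> \<phi>) = point_eval z \<phi>))"

end

theory Submission
  imports Defs
begin

text \<open>
  A weak* continuous character of the quotient pulls back to one of \<open>F\<^sub>n\<^sup>\<infinity>\<close>, which is the evaluation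
  at a point \<open>z\<close> of the ball, and this evaluation kills every element vanishing on \<open>\<Delta>\<close>. Conversely
  an evaluation at a point of \<open>\<Delta>\<close> descends to the quotient. So everything rests on separation: if
  \<open>z\<close> lies in the ball but not in \<open>\<Delta>\<close>, some element of \<open>F\<^sub>n\<^sup>\<infinity>\<close> vanishes on \<open>\<Delta>\<close> and not at \<open>z\<close>
  (\<open>blaschke_separation\<close>).

  The separating element is a noncommutative Blaschke product. For a point \<open>\<lambda>\<close> with \<open>a = \<parallel>\<lambda>\<parallel>\<close> let
  \<open>u\<close> be the linear combination of the \<open>S\<^sub>i\<close> that is a contraction with \<open>u(\<lambda>) = a\<close>. The
  polynomial \<open>(a - u) (1 + au + \<dots> + (au)\<^sup>n)\<close> vanishes at \<open>\<lambda>\<close>, and since \<open>\<parallel>(a - u) \<eta>\<parallel> \<le> \<parallel>(1 - au) \<eta>\<parallel>\<close>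
  its norm is at most \<open>1 + a\<^sup>n\<^sup>+\<^sup>1\<close>. Scaled to a contraction \<open>b\<close>, and with \<open>n\<close> large, it satisfies
  \<open>1 - b(0) \<le> 2 (1 - a)\<close> (\<open>polynomial_blaschke_factor\<close>).

  Why a product of such contractions converges: if \<open>Q\<close> is a contraction then
  \<open>\<parallel>Q1 - 1\<parallel>\<^sup>2 \<le> 2 - 2 Re \<langle>Q1, 1\<rangle>\<close>, and the vacuum expectation \<open>\<langle>Q1, 1\<rangle> = Q(0)\<close> is multiplicative. So
  the summability of \<open>1 - \<parallel>\<lambda>\<^sub>j\<parallel>\<close> makes the partial products a Cauchy sequence on the vacuum. An
  element of \<open>F\<^sub>n\<^sup>\<infinity>\<close> is left convolution by the coefficients of its value at the vacuum
  (\<open>hardy_coeff\<close>), so contractive sequences that converge there converge in the weak operator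
  topology (\<open>hardy_contractive_limit\<close>, \<open>infinite_product\<close>). The same estimate, paired with the kernel
  vector of \<open>z\<close>, shows that the product over a sufficiently late tail is close to \<open>1\<close> at \<open>z\<close>, hence
  nonzero there. The finitely many remaining points are annihilated by factors \<open>S\<^sub>i - \<lambda>\<^sub>i\<close> that do
  not vanish at \<open>z\<close>.

  Evaluation at \<open>z\<close> is realised as pairing with the kernel vector \<open>\<Sum>\<^sub>w cnj (z\<^sup>w) e\<^sub>w\<close>, a joint
  eigenvector of the adjoints \<open>S\<^sub>i\<^sup>*\<close>; this gives multiplicativity (\<open>evaluation_mult\<close>). That every
  weak* continuous character comes from the open ball follows from powers of a row contraction
  tending weakly to \<open>0\<close> (\<open>hardy_character_in_ball\<close>).
\<close>

section \<open>Hilbert space geometry of the Fock space\<close>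

lemma fock_eqI: "(\<And>w. coeff_fock \<xi> w = coeff_fock \<eta> w) \<Longrightarrow> \<xi> = \<eta>"
  by (simp add: coeff_fock_inject[symmetric] fun_eq_iff)

lemmas fock_coeff_simps [simp] =
  zero_fock.rep_eq plus_fock.rep_eq minus_fock.rep_eq uminus_fock.rep_eq
  scaleR_fock.rep_eq cscale_fock.rep_eq

lemma cinner_add_left: "cinner_fock (\<xi> + \<eta>) \<zeta> = cinner_fock \<xi> \<zeta> + cinner_fock \<eta> \<zeta>"
  by (simp add: cinner_fock_def distrib_right infsum_add[OF summable_cinner_fock summable_cinner_fock])

lemma cinner_scale_left: "cinner_fock (cscale_fock c \<xi>) \<zeta> = c * cinner_fock \<xi> \<zeta>"
  by (simp add: cinner_fock_def mult.assoc infsum_cmult_right summable_cinner_fock)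

lemma cinner_zero_left [simp]: "cinner_fock 0 \<zeta> = 0"
  by (simp add: cinner_fock_def)

lemma cinner_commute: "cinner_fock \<eta> \<xi> = cnj (cinner_fock \<xi> \<eta>)"
  unfolding cinner_fock_def infsum_cnj[symmetric] by (simp add: mult.commute)

lemma cinner_add_right: "cinner_fock \<zeta> (\<xi> + \<eta>) = cinner_fock \<zeta> \<xi> + cinner_fock \<zeta> \<eta>"
  by (metis cinner_add_left cinner_commute complex_cnj_add)

lemma cinner_scale_right: "cinner_fock \<zeta> (cscale_fock c \<xi>) = cnj c * cinner_fock \<zeta> \<xi>"
  by (metis cinner_scale_left cinner_commute complex_cnj_mult)

lemma cinner_diff_left: "cinner_fock (\<xi> - \<eta>) \<zeta> = cinner_fock \<xi> \<zeta> - cinner_fock \<eta> \<zeta>"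
  using cinner_add_left[of "\<xi> - \<eta>" \<eta> \<zeta>] by simp

lemma cinner_diff_right: "cinner_fock \<zeta> (\<xi> - \<eta>) = cinner_fock \<zeta> \<xi> - cinner_fock \<zeta> \<eta>"
  using cinner_add_right[of \<zeta> "\<xi> - \<eta>" \<eta>] by simp

lemma cscale_fock_of_real: "cscale_fock (complex_of_real r) \<xi> = r *\<^sub>R \<xi>"
  by (rule fock_eqI) simp

lemma Re_cinner: "Re (cinner_fock \<xi> \<eta>) = \<xi> \<bullet> \<eta>"
  by (simp add: inner_fock_def)

text \<open>Rotating \<open>\<xi>\<close> by a phase makes the complex inner product real and leaves the norm alone.\<close>

lemma cinner_Cauchy_Schwarz: "cmod (cinner_fock \<xi> \<eta>) \<le> norm \<xi> * norm \<eta>"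
proof (cases "cinner_fock \<xi> \<eta> = 0")
  case False
  define p where "p = cnj (cinner_fock \<xi> \<eta>) / cmod (cinner_fock \<xi> \<eta>)"
  have p: "cmod p = 1" using False by (simp add: p_def norm_divide)
  have "p * cinner_fock \<xi> \<eta> = cmod (cinner_fock \<xi> \<eta>)"
    using False complex_norm_square[of "cinner_fock \<xi> \<eta>"]
    by (simp add: p_def field_simps power2_eq_square)
  then have "cmod (cinner_fock \<xi> \<eta>) = Re (cinner_fock (cscale_fock p \<xi>) \<eta>)"
    by (simp add: cinner_scale_left)
  also have "\<dots> \<le> norm (cscale_fock p \<xi>) * norm \<eta>"
    unfolding Re_cinner by (rule norm_cauchy_schwarz)
  finally show ?thesis by (simp add: norm_cscale_fock p)
qed simp

lift_definition word_vector :: "'n list \<Rightarrow> 'n fock" is "\<lambda>v w. if w = v then 1 else 0"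
  subgoal for v
    by (rule finite_nonzero_values_imp_summable_on) (rule finite_subset[of _ "{v}"], auto)
  done

abbreviation vacuum :: "'n fock" where "vacuum \<equiv> word_vector []"

lemma cinner_word_vector: "cinner_fock \<xi> (word_vector w) = coeff_fock \<xi> w"
proof -
  have "cinner_fock \<xi> (word_vector w) = (\<Sum>\<^sub>\<infinity>v\<in>{w}. coeff_fock \<xi> v)"
    unfolding cinner_fock_def by (rule infsum_cong_neutral) (auto simp: word_vector.rep_eq)
  then show ?thesis by simp
qed

lemma norm_word_vector [simp]: "norm (word_vector w) = 1"
proof -
  have "(norm (word_vector w))\<^sup>2 = 1"
    by (simp add: power2_norm_eq_inner inner_fock_def cinner_word_vector word_vector.rep_eq)
  then show ?thesis by (metis norm_ge_zero power2_eq_1_iff not_one_le_zero neg_0_le_iff_le)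
qed

lemma norm_coeff_le: "cmod (coeff_fock \<xi> w) \<le> norm \<xi>"
  using cinner_Cauchy_Schwarz[of \<xi> "word_vector w"] by (simp add: cinner_word_vector)

text \<open>
  Fatou's lemma for square sums. Membership of the limit in the Fock space comes for free, so it
  also serves as the completeness needed to construct limits of operators vector by vector.
\<close>

lemma bounded_coeff_limit:
  fixes Y :: "nat \<Rightarrow> 'n fock"
  assumes bnd: "\<And>m. norm (Y m) \<le> B"
    and lim: "\<And>w. (\<lambda>m. coeff_fock (Y m) w) \<longlonglongrightarrow> f w"
  obtains x where "\<And>w. coeff_fock x w = f w" "norm x \<le> B"
proof -
  have B: "B \<ge> 0" using bnd[of 0] norm_ge_zero[of "Y 0"] by linarith
  have fin: "(\<Sum>w\<in>F. (cmod (f w))\<^sup>2) \<le> B\<^sup>2" if "finite F" for F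
  proof (rule tendsto_upperbound)
    show "(\<lambda>m. \<Sum>w\<in>F. (cmod (coeff_fock (Y m) w))\<^sup>2) \<longlonglongrightarrow> (\<Sum>w\<in>F. (cmod (f w))\<^sup>2)"
      by (intro tendsto_intros lim)
    show "\<forall>\<^sub>F m in sequentially. (\<Sum>w\<in>F. (cmod (coeff_fock (Y m) w))\<^sup>2) \<le> B\<^sup>2"
    proof (intro always_eventually allI)
      fix m
      have "(\<Sum>w\<in>F. (cmod (coeff_fock (Y m) w))\<^sup>2) \<le> (norm (Y m))\<^sup>2"
        unfolding norm_fock_square
        by (rule finite_sum_le_infsum[OF square_summable_coeff that]) auto
      also have "\<dots> \<le> B\<^sup>2" by (rule power_mono[OF bnd]) simp
      finally show "(\<Sum>w\<in>F. (cmod (coeff_fock (Y m) w))\<^sup>2) \<le> B\<^sup>2" .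
    qed
  qed simp
  have sq: "(\<lambda>w. (cmod (f w))\<^sup>2) summable_on UNIV"
    by (rule nonneg_bdd_above_summable_on) (auto intro!: bdd_aboveI[of _ "B\<^sup>2"] fin)
  define x where "x = Abs_fock f"
  have coeff: "coeff_fock x w = f w" for w
    using sq by (simp add: x_def Abs_fock_inverse)
  have "(norm x)\<^sup>2 \<le> B\<^sup>2"
    unfolding norm_fock_square coeff by (rule infsum_le_finite_sums[OF sq fin])
  then have "norm x \<le> B" using B by (simp add: power2_le_iff_abs_le)
  with coeff that show ?thesis by blast
qed

lemma fock_truncation:
  fixes \<eta> :: "'n fock"
  assumes "e > 0"
  obtains F \<theta> where "finite F" "\<And>w. coeff_fock \<theta> w = (if w \<in> F then coeff_fock \<eta> w else 0)"
    "norm (\<eta> - \<theta>) < e"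
proof -
  let ?s = "\<lambda>w. (cmod (coeff_fock \<eta> w))\<^sup>2"
  have "(?s has_sum infsum ?s UNIV) UNIV"
    using square_summable_coeff by (rule has_sum_infsum)
  then have "\<forall>\<^sub>F F in finite_subsets_at_top UNIV. dist (sum ?s F) (infsum ?s UNIV) < e\<^sup>2"
    unfolding has_sum_def using assms by (simp add: tendstoD)
  then obtain F where F: "finite F" "dist (sum ?s F) (infsum ?s UNIV) < e\<^sup>2"
    unfolding eventually_finite_subsets_at_top by blast
  define \<theta> where "\<theta> = Abs_fock (\<lambda>w. if w \<in> F then coeff_fock \<eta> w else 0)"
  have "(\<lambda>w. (cmod (if w \<in> F then coeff_fock \<eta> w else 0))\<^sup>2) summable_on UNIV"
    by (rule finite_nonzero_values_imp_summable_on) (rule finite_subset[OF _ F(1)], auto)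
  then have \<theta>: "coeff_fock \<theta> w = (if w \<in> F then coeff_fock \<eta> w else 0)" for w
    by (simp add: \<theta>_def Abs_fock_inverse)
  have "(norm (\<eta> - \<theta>))\<^sup>2 = infsum ?s (UNIV - F)"
    unfolding norm_fock_square by (rule infsum_cong_neutral) (auto simp: \<theta>)
  also have "\<dots> = infsum ?s UNIV - infsum ?s F"
    by (rule infsum_Diff[OF square_summable_coeff]) (auto simp: F)
  also have "\<dots> < e\<^sup>2" using F by (simp add: dist_real_def)
  finally have "norm (\<eta> - \<theta>) < e" using assms by (simp add: power_less_imp_less_base)
  with F \<theta> that show ?thesis by blast
qed

text \<open>
  On bounded sets, convergence of all coefficients is weak convergence, because the finitely
  supported vectors are dense.
\<close>

lemma bounded_coeff_tendsto_weak:
  fixes Y :: "nat \<Rightarrow> 'n fock"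
  assumes bnd: "\<And>m. norm (Y m) \<le> B"
    and lim: "\<And>w. (\<lambda>m. coeff_fock (Y m) w) \<longlonglongrightarrow> coeff_fock x w"
  shows "(\<lambda>m. cinner_fock (Y m) \<eta>) \<longlonglongrightarrow> cinner_fock x \<eta>"
proof (rule LIMSEQ_I)
  fix e :: real assume e: "e > 0"
  define C where "C = B + norm x + 1"
  have C: "C > 0" "norm (Y m - x) \<le> C" for m
    using bnd[of 0] bnd[of m] norm_ge_zero[of "Y 0"] norm_ge_zero[of x] norm_triangle_ineq4[of "Y m" x]
    unfolding C_def by linarith+
  from e C(1) have "e / (2 * C) > 0" by simp
  from fock_truncation[OF this, of \<eta>] obtain F \<theta> where F: "finite F"
    and \<theta>: "\<And>w. coeff_fock \<theta> w = (if w \<in> F then coeff_fock \<eta> w else 0)"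
    and small: "norm (\<eta> - \<theta>) < e / (2 * C)" by metis
  have fin: "cinner_fock \<zeta> \<theta> = (\<Sum>w\<in>F. coeff_fock \<zeta> w * cnj (coeff_fock \<eta> w))" for \<zeta>
  proof -
    have "cinner_fock \<zeta> \<theta> = (\<Sum>\<^sub>\<infinity>w\<in>F. coeff_fock \<zeta> w * cnj (coeff_fock \<eta> w))"
      unfolding cinner_fock_def by (rule infsum_cong_neutral) (auto simp: \<theta>)
    with F show ?thesis by simp
  qed
  have "(\<lambda>m. cinner_fock (Y m) \<theta>) \<longlonglongrightarrow> cinner_fock x \<theta>"
    unfolding fin by (intro tendsto_intros lim)
  then obtain N where N: "\<And>m. m \<ge> N \<Longrightarrow> cmod (cinner_fock (Y m) \<theta> - cinner_fock x \<theta>) < e / 2"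
    using LIMSEQ_D[of _ _ "e / 2"] e by (metis half_gt_zero)
  have "cmod (cinner_fock (Y m) \<eta> - cinner_fock x \<eta>) < e" if "m \<ge> N" for m
  proof -
    have "cinner_fock (Y m) \<eta> - cinner_fock x \<eta>
        = (cinner_fock (Y m) \<theta> - cinner_fock x \<theta>) + cinner_fock (Y m - x) (\<eta> - \<theta>)"
      by (simp add: cinner_diff_left cinner_diff_right)
    moreover have "cmod (cinner_fock (Y m - x) (\<eta> - \<theta>)) \<le> C * (e / (2 * C))"
      using cinner_Cauchy_Schwarz[of "Y m - x" "\<eta> - \<theta>"] C small
      by (meson less_imp_le mult_mono norm_ge_zero order_trans)
    then have "cmod (cinner_fock (Y m - x) (\<eta> - \<theta>)) \<le> e / 2" using C by simp
    ultimately show ?thesis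
      using N[OF that] norm_triangle_ineq[of "cinner_fock (Y m) \<theta> - cinner_fock x \<theta>"
          "cinner_fock (Y m - x) (\<eta> - \<theta>)"] by simp
  qed
  then show "\<exists>N. \<forall>m\<ge>N. norm (cinner_fock (Y m) \<eta> - cinner_fock x \<eta>) < e" by blast
qed

section \<open>The weak operator topology\<close>

lemma fock_ops_iff: "T \<in> fock_ops \<longleftrightarrow>
    (\<forall>c \<xi>. blinfun_apply T (cscale_fock c \<xi>) = cscale_fock c (blinfun_apply T \<xi>))"
  by (simp add: fock_ops_def)

lemma topspace_wot: "topspace wot = fock_ops"
proof -
  have "fock_ops \<in> {{T \<in> fock_ops. cinner_fock (blinfun_apply T \<xi>) \<eta> \<in> U} | \<xi> \<eta> U. open U}"
    by (rule CollectI, intro exI[of _ 0] exI[of _ UNIV]) auto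
  then show ?thesis by (auto simp: wot_def)
qed

lemma continuous_map_matrix_coeff:
  "continuous_map wot euclidean (\<lambda>T. cinner_fock (blinfun_apply T \<xi>) \<eta>)"
  unfolding continuous_map_def topspace_wot open_openin[symmetric]
  by (auto simp: wot_def intro!: topology_generated_by_Basis)

lemma continuous_map_coeff:
  "continuous_map wot euclidean (\<lambda>T. coeff_fock (blinfun_apply T \<xi>) w)"
  using continuous_map_matrix_coeff[of \<xi> "word_vector w"] by (simp add: cinner_word_vector)

lemma continuous_map_into_wot:
  fixes g :: "'a \<Rightarrow> ('n fock \<Rightarrow>\<^sub>L 'n fock)"
  assumes "\<And>T. T \<in> topspace Y \<Longrightarrow> g T \<in> fock_ops"
    and "\<And>\<xi> \<eta>. continuous_map Y euclidean (\<lambda>T. cinner_fock (blinfun_apply (g T) \<xi>) \<eta>)"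
  shows "continuous_map Y wot g"
  unfolding wot_def
proof (rule continuous_on_generated_topo)
  fix V :: "('n fock \<Rightarrow>\<^sub>L 'n fock) set"
  assume "V \<in> {{T \<in> fock_ops. cinner_fock (blinfun_apply T \<xi>) \<eta> \<in> U} | \<xi> \<eta> U. open U}"
  then obtain \<xi> \<eta> U where V: "V = {T \<in> fock_ops. cinner_fock (blinfun_apply T \<xi>) \<eta> \<in> U}" "open U"
    by blast
  have "g -` V \<inter> topspace Y = {T \<in> topspace Y. cinner_fock (blinfun_apply (g T) \<xi>) \<eta> \<in> U}"
    using assms(1) V by auto
  also have "openin Y \<dots>"
    by (rule openin_continuous_map_preimage[OF assms(2)]) (use V in simp)
  finally show "openin Y (g -` V \<inter> topspace Y)" .
next
  show "g ` topspace Y \<subseteq> \<Union> {{T \<in> fock_ops. cinner_fock (blinfun_apply T \<xi>) \<eta> \<in> U} | \<xi> \<eta> U. open U}"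
    unfolding topology_generated_by_topspace[symmetric] wot_def[symmetric] topspace_wot
    using assms(1) by auto
qed

lemma limitin_wotI:
  assumes "T \<in> fock_ops" "\<And>m. Y m \<in> fock_ops"
    and "\<And>\<xi> \<eta>. (\<lambda>m. cinner_fock (blinfun_apply (Y m) \<xi>) \<eta>) \<longlonglongrightarrow> cinner_fock (blinfun_apply T \<xi>) \<eta>"
  shows "limitin wot Y T sequentially"
  unfolding limitin_def
proof (intro conjI allI impI)
  show "T \<in> topspace wot" using assms by (simp add: topspace_wot)
  fix U assume U: "openin wot U \<and> T \<in> U"
  then have "generate_topology_on
      {{T \<in> fock_ops. cinner_fock (blinfun_apply T \<xi>) \<eta> \<in> U} | \<xi> \<eta> U. open U} U"
    unfolding wot_def openin_topology_generated_by_iff by blast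
  then have "T \<in> U \<Longrightarrow> \<forall>\<^sub>F m in sequentially. Y m \<in> U"
  proof induction
    case (Int A B)
    then show ?case by (auto intro: eventually_conj)
  next
    case (UN K)
    then obtain k where "k \<in> K" "T \<in> k" by blast
    with UN.IH[of k] show ?case by (auto elim: eventually_mono)
  next
    case (Basis S)
    then obtain \<xi> \<eta> V where S: "S = {T \<in> fock_ops. cinner_fock (blinfun_apply T \<xi>) \<eta> \<in> V}" "open V"
      by blast
    then have "cinner_fock (blinfun_apply T \<xi>) \<eta> \<in> V" using Basis by blast
    from topological_tendstoD[OF assms(3) S(2) this] show ?case
      using assms(2) by (simp add: S)
  qed simp
  then show "\<forall>\<^sub>F m in sequentially. Y m \<in> U" using U by blast
qed

section \<open>The Hardy algebra as a weak operator closure\<close>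

lemma id_in_fock_ops: "id_blinfun \<in> fock_ops"
  by (simp add: fock_ops_iff)

lemma add_in_fock_ops: "S \<in> fock_ops \<Longrightarrow> T \<in> fock_ops \<Longrightarrow> S + T \<in> fock_ops"
  by (auto simp: fock_ops_iff blinfun.add_left intro!: fock_eqI simp: distrib_left)

lemma compose_in_fock_ops: "S \<in> fock_ops \<Longrightarrow> T \<in> fock_ops \<Longrightarrow> S o\<^sub>L T \<in> fock_ops"
  by (simp add: fock_ops_iff)

lemma cscale_in_fock_ops: "S \<in> fock_ops \<Longrightarrow> cscale_op c S \<in> fock_ops"
  by (auto simp: fock_ops_iff intro!: fock_eqI)

lemma creation_algebra_fock_ops: "T \<in> creation_algebra \<Longrightarrow> T \<in> fock_ops"
  by (induction rule: creation_algebra.induct)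
     (auto intro: id_in_fock_ops creation_in_fock_ops add_in_fock_ops compose_in_fock_ops
        cscale_in_fock_ops)

lemma creation_algebra_hardy: "T \<in> creation_algebra \<Longrightarrow> T \<in> hardy_set"
  unfolding hardy_set_def
  using closure_of_subset[of creation_algebra wot] creation_algebra_fock_ops
  by (auto simp: topspace_wot)

lemma hardy_fock_ops: "T \<in> hardy_set \<Longrightarrow> T \<in> fock_ops"
  unfolding hardy_set_def using closure_of_subset_topspace[of wot] by (auto simp: topspace_wot)

lemma hardy_weak_limit:
  assumes "T \<in> fock_ops" "\<And>m. Y m \<in> hardy_set"
    and "\<And>\<xi> \<eta>. (\<lambda>m. cinner_fock (blinfun_apply (Y m) \<xi>) \<eta>) \<longlonglongrightarrow> cinner_fock (blinfun_apply T \<xi>) \<eta>"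
  shows "T \<in> hardy_set"
proof (rule limitin_closedin)
  show "limitin wot Y T sequentially"
    by (rule limitin_wotI[OF assms(1) hardy_fock_ops[OF assms(2)] assms(3)])
  show "closedin wot hardy_set" by (simp add: hardy_set_def)
qed (use assms in auto)

text \<open>Density: identities between weak operator continuous functions need only be checked on the
  generating algebra, where rule induction is available.\<close>

lemma hardy_eqI:
  fixes f g :: "('n fock \<Rightarrow>\<^sub>L 'n fock) \<Rightarrow> complex"
  assumes "T \<in> hardy_set" "continuous_map wot euclidean f" "continuous_map wot euclidean g"
    and "\<And>T. T \<in> creation_algebra \<Longrightarrow> f T = g T"
  shows "f T = g T"
  by (rule forall_in_closure_of_eq[OF assms(1)[unfolded hardy_set_def] _ assms(2,3)])
     (use assms(4) in auto)

lemma hardy_map: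
  assumes "continuous_map wot wot g" "\<And>T. T \<in> creation_algebra \<Longrightarrow> g T \<in> hardy_set" "T \<in> hardy_set"
  shows "g T \<in> hardy_set"
proof -
  have "g T \<in> g ` (wot closure_of creation_algebra)" using assms(3) by (simp add: hardy_set_def)
  also have "\<dots> \<subseteq> wot closure_of (g ` creation_algebra)"
    by (rule continuous_map_image_closure_subset[OF assms(1)])
  also have "\<dots> \<subseteq> wot closure_of hardy_set"
    by (rule closure_of_mono) (use assms(2) in auto)
  also have "\<dots> = hardy_set" by (simp add: hardy_set_def)
  finally show ?thesis .
qed

lemma continuous_map_complex_mult:
  fixes f g :: "'a \<Rightarrow> complex"
  shows "continuous_map \<tau> euclidean f \<Longrightarrow> continuous_map \<tau> euclidean g \<Longrightarrow>
    continuous_map \<tau> euclidean (\<lambda>x. f x * g x)"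
  by (simp add: continuous_map_atin tendsto_mult)

lemma hardy_add:
  assumes "S \<in> hardy_set" "T \<in> hardy_set"
  shows "S + T \<in> hardy_set"
proof -
  have cont: "continuous_map wot wot (\<lambda>S. S + T)" if "T \<in> hardy_set" for T :: "'a fock \<Rightarrow>\<^sub>L 'a fock"
    by (rule continuous_map_into_wot)
       (use that in \<open>simp_all add: topspace_wot add_in_fock_ops hardy_fock_ops blinfun.add_left
          cinner_add_left continuous_map_add continuous_map_matrix_coeff\<close>)
  have alg: "S + T \<in> hardy_set" if "S \<in> creation_algebra" "T \<in> hardy_set" for S T :: "'a fock \<Rightarrow>\<^sub>L 'a fock"
    using hardy_map[OF cont[OF creation_algebra_hardy[OF that(1)]] _ that(2)] that(1)
    by (simp add: add.commute creation_algebra.add creation_algebra_hardy)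
  show ?thesis
    by (rule hardy_map[OF cont[OF assms(2)] alg[OF _ assms(2)] assms(1)])
qed

lemma hardy_cscale:
  assumes "T \<in> hardy_set"
  shows "cscale_op c T \<in> hardy_set"
proof (rule hardy_map[OF _ _ assms])
  show "continuous_map wot wot (cscale_op c)"
    by (rule continuous_map_into_wot)
       (simp_all add: topspace_wot cinner_scale_left cscale_in_fock_ops
          continuous_map_complex_mult continuous_map_matrix_coeff)
qed (auto intro: creation_algebra_hardy creation_algebra.scale)

text \<open>The backward shift, the adjoint of a creation operator.\<close>

lift_definition annihilation :: "'n \<Rightarrow> 'n fock \<Rightarrow> 'n fock" is "\<lambda>i f w. f (i # w)"
proof -
  fix i and f :: "'n list \<Rightarrow> complex"
  assume "(\<lambda>w. (cmod (f w))\<^sup>2) summable_on UNIV"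
  then have "(\<lambda>w. (cmod (f w))\<^sup>2) summable_on range ((#) i)"
    by (rule summable_on_subset_banach) simp
  then show "(\<lambda>w. (cmod (f (i # w)))\<^sup>2) summable_on UNIV"
    by (subst (asm) summable_on_reindex) (auto simp: o_def)
qed

lemma cinner_creation: "cinner_fock (creation_fun i \<xi>) \<eta> = cinner_fock \<xi> (annihilation i \<eta>)"
proof -
  let ?h = "\<lambda>w. shift_word i (coeff_fock \<xi>) w * cnj (coeff_fock \<eta> w)"
  have zero: "?h w = 0" if "w \<notin> range ((#) i)" for w using that by (cases w) auto
  have "cinner_fock (creation_fun i \<xi>) \<eta> = infsum ?h (range ((#) i))"
    unfolding cinner_fock_def creation_fun.rep_eq
    using zero by (intro infsum_cong_neutral) auto
  also have "\<dots> = cinner_fock \<xi> (annihilation i \<eta>)"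
    unfolding cinner_fock_def by (subst infsum_reindex) (auto simp: o_def annihilation.rep_eq)
  finally show ?thesis .
qed

text \<open>
  Weak operator continuity of \<open>T \<mapsto> S o\<^sub>L T\<close> amounts to moving \<open>S\<close> to the other side of the inner
  product. On the algebra generated by the creation operators the required vector is built
  from backward shifts.
\<close>

lemma creation_algebra_adjoint:
  assumes "S \<in> creation_algebra"
  shows "\<exists>\<zeta>. \<forall>\<xi>. cinner_fock (blinfun_apply S \<xi>) \<eta> = cinner_fock \<xi> \<zeta>"
  using assms
proof (induction arbitrary: \<eta> rule: creation_algebra.induct)
  case (creation i)
  then show ?case by (auto simp: cinner_creation)
next
  case (add S T)
  then obtain \<zeta> \<zeta>' where "\<forall>\<xi>. cinner_fock (blinfun_apply S \<xi>) \<eta> = cinner_fock \<xi> \<zeta>"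
    "\<forall>\<xi>. cinner_fock (blinfun_apply T \<xi>) \<eta> = cinner_fock \<xi> \<zeta>'" by metis
  then have "\<forall>\<xi>. cinner_fock (blinfun_apply (S + T) \<xi>) \<eta> = cinner_fock \<xi> (\<zeta> + \<zeta>')"
    by (simp add: blinfun.add_left cinner_add_left cinner_add_right)
  then show ?case ..
next
  case (mult S T)
  then show ?case by simp metis
next
  case (scale S c)
  then obtain \<zeta> where "\<forall>\<xi>. cinner_fock (blinfun_apply S \<xi>) \<eta> = cinner_fock \<xi> \<zeta>" by metis
  then have "\<forall>\<xi>. cinner_fock (blinfun_apply (cscale_op c S) \<xi>) \<eta> = cinner_fock \<xi> (cscale_fock (cnj c) \<zeta>)"
    by (simp add: cinner_scale_left cinner_scale_right)
  then show ?case ..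
qed auto

text \<open>
  Multiplication is only separately continuous, so the closure is taken one factor at a time: the
  right factor passes to the limit while \<open>S\<close> is still in the generating algebra, where it has an
  adjoint; then \<open>S\<close> passes to the limit, since \<open>S \<mapsto> S o\<^sub>L T\<close> is continuous for every \<open>T\<close>.
\<close>

lemma hardy_mult:
  assumes "S \<in> hardy_set" "T \<in> hardy_set"
  shows "S o\<^sub>L T \<in> hardy_set"
proof -
  have alg: "S o\<^sub>L T \<in> hardy_set" if S: "S \<in> creation_algebra" and T: "T \<in> hardy_set"
    for S T :: "'a fock \<Rightarrow>\<^sub>L 'a fock"
  proof (rule hardy_map[OF _ _ T, of "\<lambda>T. S o\<^sub>L T"])
    show "continuous_map wot wot (\<lambda>T. S o\<^sub>L T)"
    proof (rule continuous_map_into_wot)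
      fix \<xi> \<eta> :: "'a fock"
      obtain \<zeta> where "\<forall>\<xi>. cinner_fock (blinfun_apply S \<xi>) \<eta> = cinner_fock \<xi> \<zeta>"
        using creation_algebra_adjoint[OF S] by blast
      then show "continuous_map wot euclidean (\<lambda>T. cinner_fock (blinfun_apply (S o\<^sub>L T) \<xi>) \<eta>)"
        by (simp add: continuous_map_matrix_coeff)
    qed (use S in \<open>auto simp: topspace_wot intro: compose_in_fock_ops creation_algebra_fock_ops\<close>)
  qed (use S in \<open>auto intro: creation_algebra_hardy creation_algebra.mult\<close>)
  have "continuous_map wot wot (\<lambda>S. S o\<^sub>L T)"
    by (rule continuous_map_into_wot)
       (use assms in \<open>simp_all add: topspace_wot compose_in_fock_ops hardy_fock_ops
          continuous_map_matrix_coeff\<close>)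
  from hardy_map[OF this alg[OF _ assms(2)] assms(1)] show ?thesis .
qed

section \<open>Elements of the Hardy algebra as convolution operators\<close>

text \<open>
  This is the sum of \<open>c u * d v\<close> over all factorisations \<open>w = u @ v\<close>. Recursion on the first letter
  of \<open>w\<close> makes associativity a plain induction.
\<close>

fun word_conv :: "('n list \<Rightarrow> complex) \<Rightarrow> ('n list \<Rightarrow> complex) \<Rightarrow> 'n list \<Rightarrow> complex"
  where
    "word_conv c d [] = c [] * d []"
  | "word_conv c d (i # w) = c [] * d (i # w) + word_conv (\<lambda>v. c (i # v)) d w"

lemma word_conv_zero: "word_conv (\<lambda>_. 0) d w = 0"
  by (induction w) auto

lemma word_conv_unit: "word_conv (coeff_fock vacuum) d w = d w"
  by (cases w) (auto simp: word_vector.rep_eq word_conv_zero)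

lemma word_conv_shift: "word_conv (shift_word i (coeff_fock vacuum)) d w = shift_word i d w"
proof (cases w)
  case Nil
  then show ?thesis by simp
next
  case (Cons j v)
  show ?thesis
    by (cases "j = i") (simp_all add: Cons word_conv_zero word_conv_unit)
qed

lemma word_conv_add: "word_conv (\<lambda>v. b v + c v) d w = word_conv b d w + word_conv c d w"
  by (induction w arbitrary: b c) (auto simp: algebra_simps)

lemma word_conv_scale: "word_conv (\<lambda>v. a * c v) d w = a * word_conv c d w"
  by (induction w arbitrary: c) (auto simp: algebra_simps)

lemma word_conv_assoc: "word_conv (word_conv b c) d w = word_conv b (word_conv c d) w"
  by (induction w arbitrary: b) (auto simp: algebra_simps word_conv_add word_conv_scale)

lemma tendsto_word_conv:
  assumes "\<And>v. ((\<lambda>m. c m v) \<longlongrightarrow> b v) F"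
  shows "((\<lambda>m. word_conv (c m) d w) \<longlongrightarrow> word_conv b d w) F"
  using assms
proof (induction w arbitrary: b c)
  case Nil
  then show ?case by (simp add: tendsto_mult)
next
  case (Cons i w)
  have "((\<lambda>m. word_conv (\<lambda>v. c m (i # v)) d w) \<longlongrightarrow> word_conv (\<lambda>v. b (i # v)) d w) F"
    by (rule Cons.IH) (rule Cons.prems)
  then show ?case by (simp add: tendsto_add tendsto_mult Cons.prems)
qed

lemma continuous_map_word_conv:
  assumes "\<And>v. continuous_map \<tau> euclidean (\<lambda>m. c m v)"
  shows "continuous_map \<tau> euclidean (\<lambda>m. word_conv (c m) d w)"
  using assms
proof (induction w arbitrary: c)
  case Nil
  then show ?case by (simp add: continuous_map_complex_mult)
next
  case (Cons i w)
  have "continuous_map \<tau> euclidean (\<lambda>m. word_conv (\<lambda>v. c m (i # v)) d w)"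
    by (rule Cons.IH) (rule Cons.prems)
  then show ?case by (simp add: continuous_map_add continuous_map_complex_mult Cons.prems)
qed

text \<open>
  The operators \<open>S\<^sub>i\<close> only prefix letters, so an operator of the Hardy algebra is determined by its
  action on the vacuum.
\<close>

lemma hardy_coeff:
  assumes "T \<in> hardy_set"
  shows "coeff_fock (blinfun_apply T \<xi>) w =
    word_conv (coeff_fock (blinfun_apply T vacuum)) (coeff_fock \<xi>) w"
proof (rule hardy_eqI[OF assms])
  fix T :: "'a fock \<Rightarrow>\<^sub>L 'a fock" assume "T \<in> creation_algebra"
  then show "coeff_fock (blinfun_apply T \<xi>) w =
      word_conv (coeff_fock (blinfun_apply T vacuum)) (coeff_fock \<xi>) w"
  proof (induction arbitrary: \<xi> w rule: creation_algebra.induct)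
    case one
    then show ?case by (simp add: word_conv_unit)
  next
    case (creation i)
    then show ?case by (simp add: creation_fun.rep_eq word_conv_shift)
  next
    case (add S T)
    show ?case
      by (simp only: blinfun.add_left plus_fock.rep_eq word_conv_add add.IH[where \<xi> = \<xi>])
  next
    case (mult S T)
    have eq: "coeff_fock (blinfun_apply T \<xi>) = word_conv (coeff_fock (blinfun_apply T vacuum)) (coeff_fock \<xi>)"
      "coeff_fock (blinfun_apply S (blinfun_apply T vacuum)) =
        word_conv (coeff_fock (blinfun_apply S vacuum)) (coeff_fock (blinfun_apply T vacuum))"
      by (rule ext, rule mult.IH)+
    show ?case
      unfolding blinfun_compose.rep_eq o_def mult.IH(1)[of "blinfun_apply T \<xi>"] eq(2) word_conv_assoc
      unfolding eq(1)[symmetric] ..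
  next
    case (scale S c)
    show ?case
      by (simp only: cscale_op_apply cscale_fock.rep_eq word_conv_scale scale.IH[where \<xi> = \<xi>])
  qed
next
  show "continuous_map wot euclidean
      (\<lambda>T. word_conv (coeff_fock (blinfun_apply T vacuum)) (coeff_fock \<xi>) w)"
    by (rule continuous_map_word_conv) (rule continuous_map_coeff)
qed (rule continuous_map_coeff)

text \<open>
  Consequently a contractive sequence in the Hardy algebra converges in the weak operator topology
  as soon as its action on the vacuum converges coefficientwise.
\<close>

lemma hardy_contractive_limit:
  fixes Y :: "nat \<Rightarrow> ('n fock \<Rightarrow>\<^sub>L 'n fock)"
  assumes hardy: "\<And>m. Y m \<in> hardy_set" and contr: "\<And>m \<xi>. norm (blinfun_apply (Y m) \<xi>) \<le> norm \<xi>"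
    and conv: "\<And>w. convergent (\<lambda>m. coeff_fock (blinfun_apply (Y m) vacuum) w)"
  obtains T where "T \<in> hardy_set"
    "\<And>\<xi> \<eta>. (\<lambda>m. cinner_fock (blinfun_apply (Y m) \<xi>) \<eta>) \<longlonglongrightarrow> cinner_fock (blinfun_apply T \<xi>) \<eta>"
proof -
  define c where "c w = lim (\<lambda>m. coeff_fock (blinfun_apply (Y m) vacuum) w)" for w
  have lim: "(\<lambda>m. coeff_fock (blinfun_apply (Y m) \<xi>) w) \<longlonglongrightarrow> word_conv c (coeff_fock \<xi>) w" for \<xi> w
    unfolding hardy_coeff[OF hardy, of _ \<xi>] c_def
    by (rule tendsto_word_conv) (use conv convergent_LIMSEQ_iff in blast)
  have "\<exists>x. (\<forall>w. coeff_fock x w = word_conv c (coeff_fock \<xi>) w) \<and> norm x \<le> norm \<xi>" for \<xi>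
    by (rule bounded_coeff_limit[OF contr lim]) blast
  then obtain g where g: "\<And>\<xi> w. coeff_fock (g \<xi>) w = word_conv c (coeff_fock \<xi>) w"
    and bnd: "\<And>\<xi>. norm (g \<xi>) \<le> norm \<xi>" by metis
  have limg: "(\<lambda>m. coeff_fock (blinfun_apply (Y m) \<xi>) w) \<longlonglongrightarrow> coeff_fock (g \<xi>) w" for \<xi> w
    using lim g by simp
  have lin: "bounded_linear g"
  proof (rule bounded_linear_intro[where K = 1])
    fix \<xi> \<eta> r
    show "g (\<xi> + \<eta>) = g \<xi> + g \<eta>"
    proof (rule fock_eqI, rule LIMSEQ_unique[OF limg])
      fix w show "(\<lambda>m. coeff_fock (blinfun_apply (Y m) (\<xi> + \<eta>)) w) \<longlonglongrightarrow> coeff_fock (g \<xi> + g \<eta>) w"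
        by (simp add: blinfun.add_right tendsto_add limg)
    qed
    show "g (r *\<^sub>R \<xi>) = r *\<^sub>R g \<xi>"
    proof (rule fock_eqI, rule LIMSEQ_unique[OF limg])
      fix w show "(\<lambda>m. coeff_fock (blinfun_apply (Y m) (r *\<^sub>R \<xi>)) w) \<longlonglongrightarrow> coeff_fock (r *\<^sub>R g \<xi>) w"
        by (simp add: blinfun.scaleR_right tendsto_mult limg)
    qed
    show "norm (g \<xi>) \<le> norm \<xi> * 1" using bnd by simp
  qed
  define T where "T = Blinfun g"
  have T: "blinfun_apply T = g" using lin by (simp add: T_def bounded_linear_Blinfun_apply)
  have weak: "(\<lambda>m. cinner_fock (blinfun_apply (Y m) \<xi>) \<eta>) \<longlonglongrightarrow> cinner_fock (blinfun_apply T \<xi>) \<eta>" for \<xi> \<eta>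
    unfolding T by (rule bounded_coeff_tendsto_weak[OF contr limg])
  have "T \<in> fock_ops"
    unfolding fock_ops_iff T
  proof (intro allI fock_eqI, rule LIMSEQ_unique[OF limg])
    fix a \<xi> w
    have "blinfun_apply (Y m) (cscale_fock a \<xi>) = cscale_fock a (blinfun_apply (Y m) \<xi>)" for m
      using hardy_fock_ops[OF hardy] by (simp add: fock_ops_iff)
    then show "(\<lambda>m. coeff_fock (blinfun_apply (Y m) (cscale_fock a \<xi>)) w)
        \<longlonglongrightarrow> coeff_fock (cscale_fock a (g \<xi>)) w"
      by (simp add: tendsto_mult limg)
  qed
  from hardy_weak_limit[OF this hardy weak] weak that show ?thesis by blast
qed

section \<open>Evaluation at points of the ball\<close>

text \<open>
  Grouped by length, the series is geometric: the words of length \<open>k\<close> contribute the \<open>k\<close>-th power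
  of \<open>sum p UNIV\<close>. Splitting off the first letter turns this into an induction on the length bound.
\<close>

lemma summable_prod_list:
  fixes p :: "'n::finite \<Rightarrow> real"
  assumes p: "\<And>i. p i \<ge> 0" and less: "sum p UNIV < 1"
  shows "(\<lambda>w. prod_list (map p w)) summable_on UNIV"
proof (rule nonneg_bdd_above_summable_on)
  let ?g = "\<lambda>w. prod_list (map p w)"
  show nonneg: "?g w \<ge> 0" for w by (induction w) (auto simp: p)
  let ?L = "\<lambda>K. {w :: 'n list. length w \<le> K}"
  have fin: "finite (?L K)" for K
    using finite_lists_length_le[of "UNIV :: 'n set" K] by simp
  have bound: "sum ?g (?L K) \<le> 1 / (1 - sum p UNIV)" for K
  proof (induction K)
    case 0
    have "?L 0 = {[]}" by auto
    then show ?case using less sum_nonneg[of UNIV p] p by (simp add: field_simps)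
  next
    case (Suc K)
    have split: "?L (Suc K) = insert [] ((\<lambda>(i, w). i # w) ` (UNIV \<times> ?L K))"
    proof (intro Set.set_eqI)
      show "w \<in> ?L (Suc K) \<longleftrightarrow> w \<in> insert [] ((\<lambda>(i, w). i # w) ` (UNIV \<times> ?L K))" for w :: "'n list"
        by (cases w) auto
    qed
    have "sum ?g (?L (Suc K)) = 1 + sum ?g ((\<lambda>(i, w). i # w) ` (UNIV \<times> ?L K))"
      unfolding split by (subst sum.insert) (use fin in auto)
    also have "sum ?g ((\<lambda>(i, w). i # w) ` (UNIV \<times> ?L K)) = (\<Sum>(i, w)\<in>UNIV \<times> ?L K. p i * ?g w)"
      by (subst sum.reindex) (auto simp: inj_on_def intro!: sum.cong)
    also have "\<dots> = sum p UNIV * sum ?g (?L K)"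
      by (simp add: sum.cartesian_product[symmetric] sum_product)
    also have "\<dots> \<le> sum p UNIV * (1 / (1 - sum p UNIV))"
      by (rule mult_left_mono[OF Suc.IH]) (simp add: sum_nonneg p)
    also have "1 + sum p UNIV * (1 / (1 - sum p UNIV)) = 1 / (1 - sum p UNIV)"
      using less by (simp add: field_simps)
    finally show ?case by simp
  qed
  show "bdd_above (sum ?g ` {F. F \<subseteq> UNIV \<and> finite F})"
  proof (rule bdd_aboveI2)
    fix F :: "'n list set" assume "F \<in> {F. F \<subseteq> UNIV \<and> finite F}"
    then have F: "finite F" by simp
    have "F \<subseteq> ?L (Max (length ` F))" using F by auto
    then have "sum ?g F \<le> sum ?g (?L (Max (length ` F)))"
      by (rule sum_mono2[OF fin]) (rule nonneg)
    also note bound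
    finally show "sum ?g F \<le> 1 / (1 - sum p UNIV)" .
  qed
qed

lemma norm_vec_complex: "(norm (z :: complex ^ 'n::finite))\<^sup>2 = (\<Sum>i\<in>UNIV. (cmod (z $ i))\<^sup>2)"
  by (simp add: norm_vec_def L2_set_def sum_nonneg)

text \<open>
  The reproducing kernel vector at \<open>z\<close>: pairing with it evaluates the power series
  \<open>\<Sum>\<^sub>w \<xi>\<^sub>w z\<^sup>w\<close>, and it is a joint eigenvector of the adjoints of the creation operators.
\<close>

definition kernel :: "complex ^ 'n::finite \<Rightarrow> 'n fock"
  where "kernel z = Abs_fock (\<lambda>w. prod_list (map (\<lambda>i. cnj (z $ i)) w))"

lemma coeff_kernel:
  assumes "norm z < 1"
  shows "coeff_fock (kernel z) w = prod_list (map (\<lambda>i. cnj (z $ i)) w)"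
proof -
  have "(cmod (prod_list (map (\<lambda>i. cnj (z $ i)) w)))\<^sup>2 = prod_list (map (\<lambda>i. (cmod (z $ i))\<^sup>2) w)" for w
    by (induction w) (simp_all add: norm_mult power_mult_distrib)
  moreover have "(\<Sum>i\<in>UNIV. (cmod (z $ i))\<^sup>2) < 1"
    using assms by (simp add: norm_vec_complex[symmetric] power_less_one_iff)
  ultimately have "(\<lambda>w. (cmod (prod_list (map (\<lambda>i. cnj (z $ i)) w)))\<^sup>2) summable_on UNIV"
    using summable_prod_list[of "\<lambda>i. (cmod (z $ i))\<^sup>2"] by simp
  then show ?thesis by (simp add: kernel_def Abs_fock_inverse)
qed

lemma kernel_0: "kernel 0 = vacuum"
proof (rule fock_eqI)
  show "coeff_fock (kernel 0) w = coeff_fock vacuum w" for w :: "'a list"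
    by (cases w) (auto simp: coeff_kernel word_vector.rep_eq)
qed

lemma annihilation_kernel:
  "norm z < 1 \<Longrightarrow> annihilation i (kernel z) = cscale_fock (cnj (z $ i)) (kernel z)"
  by (rule fock_eqI) (simp add: annihilation.rep_eq coeff_kernel)

definition evaluation :: "complex ^ 'n::finite \<Rightarrow> ('n fock \<Rightarrow>\<^sub>L 'n fock) \<Rightarrow> complex"
  where "evaluation z T = cinner_fock (blinfun_apply T vacuum) (kernel z)"

lemma continuous_map_evaluation: "continuous_map wot euclidean (evaluation z)"
  unfolding evaluation_def by (rule continuous_map_matrix_coeff)

lemma evaluation_add: "evaluation z (S + T) = evaluation z S + evaluation z T"
  by (simp add: evaluation_def blinfun.add_left cinner_add_left)

lemma evaluation_cscale: "evaluation z (cscale_op c T) = c * evaluation z T"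
  by (simp add: evaluation_def cinner_scale_left)

lemma evaluation_zero: "evaluation z 0 = 0"
  by (simp add: evaluation_def)

lemma evaluation_sum: "finite I \<Longrightarrow> evaluation z (sum f I) = (\<Sum>i\<in>I. evaluation z (f i))"
  by (induction I rule: finite_induct) (simp_all add: evaluation_zero evaluation_add)

lemma cinner_vacuum_kernel: "norm z < 1 \<Longrightarrow> cinner_fock vacuum (kernel z) = 1"
  by (subst cinner_commute) (simp add: cinner_word_vector coeff_kernel)

lemma evaluation_id: "norm z < 1 \<Longrightarrow> evaluation z id_blinfun = 1"
  by (simp add: evaluation_def cinner_vacuum_kernel)

lemma evaluation_creation: "norm z < 1 \<Longrightarrow> evaluation z (creation i) = z $ i"
  by (simp add: evaluation_def cinner_creation annihilation_kernel cinner_scale_right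
      cinner_vacuum_kernel)

text \<open>
  The kernel vector spans a line invariant under all adjoints, so compression to it is
  multiplicative.
\<close>

lemma cinner_hardy_kernel:
  assumes z: "norm z < 1" and "T \<in> hardy_set"
  shows "cinner_fock (blinfun_apply T \<xi>) (kernel z) = evaluation z T * cinner_fock \<xi> (kernel z)"
proof (rule hardy_eqI[OF assms(2)])
  fix T :: "'a fock \<Rightarrow>\<^sub>L 'a fock" assume "T \<in> creation_algebra"
  then have "\<exists>c. \<forall>\<xi>. cinner_fock (blinfun_apply T \<xi>) (kernel z) = c * cinner_fock \<xi> (kernel z)"
  proof induction
    case one
    show ?case by (intro exI[of _ 1]) simp
  next
    case (creation i)
    show ?case
      by (intro exI[of _ "z $ i"]) (simp add: cinner_creation annihilation_kernel z cinner_scale_right)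
  next
    case (add S T)
    then obtain c d where
      "\<forall>\<xi>. cinner_fock (blinfun_apply S \<xi>) (kernel z) = c * cinner_fock \<xi> (kernel z)"
      "\<forall>\<xi>. cinner_fock (blinfun_apply T \<xi>) (kernel z) = d * cinner_fock \<xi> (kernel z)" by blast
    then show ?case
      by (intro exI[of _ "c + d"]) (simp add: blinfun.add_left cinner_add_left distrib_right)
  next
    case (mult S T)
    then obtain c d where
      "\<forall>\<xi>. cinner_fock (blinfun_apply S \<xi>) (kernel z) = c * cinner_fock \<xi> (kernel z)"
      "\<forall>\<xi>. cinner_fock (blinfun_apply T \<xi>) (kernel z) = d * cinner_fock \<xi> (kernel z)" by blast
    then show ?case by (intro exI[of _ "c * d"]) simp
  next
    case (scale S c)
    then obtain d where
      "\<forall>\<xi>. cinner_fock (blinfun_apply S \<xi>) (kernel z) = d * cinner_fock \<xi> (kernel z)" by blast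
    then show ?case by (intro exI[of _ "c * d"]) (simp add: cinner_scale_left)
  qed
  then obtain c where c: "\<And>\<xi>. cinner_fock (blinfun_apply T \<xi>) (kernel z) = c * cinner_fock \<xi> (kernel z)"
    by blast
  then show "cinner_fock (blinfun_apply T \<xi>) (kernel z) = evaluation z T * cinner_fock \<xi> (kernel z)"
    by (simp add: evaluation_def cinner_vacuum_kernel z)
next
  show "continuous_map wot euclidean (\<lambda>T. evaluation z T * cinner_fock \<xi> (kernel z))"
    by (intro continuous_map_complex_mult continuous_map_evaluation) simp
qed (rule continuous_map_matrix_coeff)

lemma evaluation_mult:
  "norm z < 1 \<Longrightarrow> S \<in> hardy_set \<Longrightarrow> evaluation z (S o\<^sub>L T) = evaluation z S * evaluation z T"
  by (simp add: evaluation_def[of z "S o\<^sub>L T"] evaluation_def[of z T] cinner_hardy_kernel)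

section \<open>Row combinations of the creation operators\<close>

definition row_operator :: "('n::finite \<Rightarrow> complex) \<Rightarrow> ('n fock \<Rightarrow>\<^sub>L 'n fock)"
  where "row_operator c = (\<Sum>i\<in>UNIV. cscale_op (c i) (creation i))"

lemma row_operator_in_algebra: "row_operator c \<in> creation_algebra"
proof -
  have zero: "(0 :: 'a fock \<Rightarrow>\<^sub>L 'a fock) = cscale_op 0 id_blinfun"
    by (rule blinfun_eqI, rule fock_eqI) simp
  have "(\<Sum>i\<in>I. cscale_op (c i) (creation i)) \<in> creation_algebra" if "finite I" for I
    using that
  proof induction
    case empty
    then show ?case by (simp add: zero creation_algebra.one creation_algebra.scale)
  qed (simp add: creation_algebra.intros)
  then show ?thesis by (simp add: row_operator_def)
qed

lemma row_operator_apply: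
  "blinfun_apply (row_operator c) \<xi> = (\<Sum>i\<in>UNIV. cscale_fock (c i) (creation_fun i \<xi>))"
  by (simp add: row_operator_def blinfun.sum_left)

lemma evaluation_row_operator:
  "norm z < 1 \<Longrightarrow> evaluation z (row_operator c) = (\<Sum>i\<in>UNIV. c i * z $ i)"
  by (simp add: row_operator_def evaluation_sum evaluation_cscale evaluation_creation)

lemma norm_creation_fun: "norm (creation_fun i \<xi>) = norm \<xi>"
proof -
  have "(norm (creation_fun i \<xi>))\<^sup>2 = (norm \<xi>)\<^sup>2"
    by (simp add: norm_fock_square creation_fun.rep_eq
        shift_word_square_summable(2)[OF square_summable_coeff])
  then show ?thesis by simp
qed

text \<open>The creation operators are isometries with pairwise orthogonal ranges.\<close>

lemma norm_row_operator:
  "(norm (blinfun_apply (row_operator c) \<xi>))\<^sup>2 = (\<Sum>i\<in>UNIV. (cmod (c i))\<^sup>2) * (norm \<xi>)\<^sup>2"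
proof -
  have "annihilation i (creation_fun j \<xi>) = 0" if "i \<noteq> j" for i j
    by (rule fock_eqI) (use that in \<open>simp add: annihilation.rep_eq creation_fun.rep_eq\<close>)
  then have "pairwise (\<lambda>i j. orthogonal (cscale_fock (c i) (creation_fun i \<xi>))
      (cscale_fock (c j) (creation_fun j \<xi>))) UNIV"
    by (simp add: pairwise_def orthogonal_def inner_fock_def cinner_scale_left cinner_scale_right
        cinner_creation) (simp add: cinner_fock_def)
  from norm_sum_Pythagorean[OF _ this] show ?thesis
    by (simp add: row_operator_apply norm_cscale_fock norm_creation_fun power_mult_distrib
        sum_distrib_right)
qed

lemma row_operator_contraction:
  assumes "(\<Sum>i\<in>UNIV. (cmod (c i))\<^sup>2) \<le> 1"
  shows "norm (blinfun_apply (row_operator c) \<xi>) \<le> norm \<xi>"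
proof -
  have "(norm (blinfun_apply (row_operator c) \<xi>))\<^sup>2 \<le> 1 * (norm \<xi>)\<^sup>2"
    unfolding norm_row_operator by (rule mult_right_mono[OF assms]) simp
  then show ?thesis by (simp add: power2_le_iff_abs_le)
qed

lemma row_operator_funpow_contraction:
  assumes "(\<Sum>i\<in>UNIV. (cmod (c i))\<^sup>2) \<le> 1"
  shows "norm ((blinfun_apply (row_operator c) ^^ k) \<xi>) \<le> norm \<xi>"
  by (induction k) (auto intro: order_trans[OF row_operator_contraction[OF assms]])

lemma coeff_sum: "finite I \<Longrightarrow> coeff_fock (sum f I) w = (\<Sum>i\<in>I. coeff_fock (f i) w)"
  by (induction I rule: finite_induct) simp_all

lemma coeff_row_operator_funpow:
  "length w < k \<Longrightarrow> coeff_fock ((blinfun_apply (row_operator c) ^^ k) \<xi>) w = 0"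
proof (induction k arbitrary: w)
  case (Suc k)
  then show ?case
    by (cases w) (auto simp: row_operator_apply coeff_sum creation_fun.rep_eq intro!: sum.neutral)
qed simp

section \<open>Polynomial Blaschke factors\<close>

text \<open>
  The operator form of \<open>\<bar>a - t\<bar> \<le> \<bar>1 - a t\<bar>\<close> on the unit disc, with \<open>y\<close> in the role of \<open>u x\<close> for a
  contraction \<open>u\<close>: the cross terms of the two squares agree, and the rest factors.
\<close>

lemma norm_blaschke_numerator_le:
  fixes x y :: "'a::real_inner"
  assumes "0 \<le> a" "a \<le> 1" "norm y \<le> norm x"
  shows "norm (a *\<^sub>R x - y) \<le> norm (x - a *\<^sub>R y)"
proof -
  have "(norm (x - a *\<^sub>R y))\<^sup>2 - (norm (a *\<^sub>R x - y))\<^sup>2 = (1 - a\<^sup>2) * ((norm x)\<^sup>2 - (norm y)\<^sup>2)"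
    unfolding power2_norm_eq_inner power2_eq_square[of a]
    by (simp add: inner_diff_left inner_diff_right inner_commute[of y x] algebra_simps
        del: dot_square_norm)
  also have "\<dots> \<ge> 0"
    using assms by (intro mult_nonneg_nonneg) (simp_all add: power_le_one power_mono)
  finally show ?thesis by (simp add: power2_le_iff_abs_le)
qed

text \<open>
  With \<open>a = \<parallel>\<lambda>\<parallel>\<close> and \<open>u\<close> the row contraction with \<open>u(\<lambda>) = a\<close>, the factor is
  \<open>(a - u) (1 + au + \<dots> + (au)\<^sup>n) / (1 + a\<^sup>n\<^sup>+\<^sup>1)\<close>, a truncation of the Blaschke function of \<open>u\<close> in
  which the numerator, hence the zero at \<open>\<lambda>\<close>, is kept intact. By the preceding inequality it is
  bounded by the norm of \<open>(1 - au) (1 + au + \<dots> + (au)\<^sup>n) = 1 - (au)\<^sup>n\<^sup>+\<^sup>1\<close>, and the denominator turns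
  it into a contraction. Taking \<open>n\<close> large keeps the constant coefficient within \<open>2 (1 - a)\<close> of \<open>1\<close>.
\<close>

lemma polynomial_blaschke_factor:
  fixes l :: "complex ^ 'n::finite"
  assumes l: "norm l < 1"
  shows "\<exists>b \<beta>. b \<in> creation_algebra \<and> (\<forall>\<xi>. norm (blinfun_apply b \<xi>) \<le> norm \<xi>) \<and>
    evaluation l b = 0 \<and> evaluation 0 b = complex_of_real \<beta> \<and> 0 \<le> \<beta> \<and> \<beta> \<le> 1 \<and>
    1 - \<beta> \<le> 2 * (1 - norm l)"
proof -
  define a where "a = norm l"
  have a: "0 \<le> a" "a < 1" using l by (auto simp: a_def)
  \<comment> \<open>For \<open>l = 0\<close> the division by zero makes \<open>u\<close> the zero operator.\<close>
  define c where "c i = cnj (l $ i) / complex_of_real a" for i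
  define u where "u = row_operator c"
  have "(\<Sum>i\<in>UNIV. (cmod (c i))\<^sup>2) = (\<Sum>i\<in>UNIV. (cmod (l $ i))\<^sup>2) / a\<^sup>2"
    using a by (simp add: c_def norm_divide power_divide sum_divide_distrib)
  also have "\<dots> \<le> 1" by (simp add: a_def norm_vec_complex[symmetric])
  finally have c: "(\<Sum>i\<in>UNIV. (cmod (c i))\<^sup>2) \<le> 1" .
  have u: "u \<in> creation_algebra" by (simp add: u_def row_operator_in_algebra)
  have ul: "evaluation l u = a"
  proof -
    have "evaluation l u = (\<Sum>i\<in>UNIV. complex_of_real ((cmod (l $ i))\<^sup>2)) / a"
      unfolding u_def evaluation_row_operator[OF l] c_def sum_divide_distrib
      by (rule sum.cong) (simp_all add: complex_norm_square mult.commute del: of_real_power)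
    also have "\<dots> = complex_of_real (a\<^sup>2) / a"
      by (simp only: of_real_sum[symmetric] norm_vec_complex[symmetric] a_def)
    finally show ?thesis by (simp add: power2_eq_square)
  qed
  have u0: "evaluation 0 u = 0" by (simp add: u_def evaluation_row_operator)
  \<comment> \<open>The truncation error must be summable along the sequence of points, like \<open>1 - a\<close>.\<close>
  obtain n where "a ^ n < 1 - a" using real_arch_pow_inv[of "1 - a" a] a by auto
  define \<epsilon> where "\<epsilon> = a ^ Suc n"
  have \<epsilon>: "0 \<le> \<epsilon>" "\<epsilon> \<le> 1 - a"
  proof -
    show "0 \<le> \<epsilon>" using a by (simp add: \<epsilon>_def)
    have "\<epsilon> \<le> a ^ n" unfolding \<epsilon>_def using a by (intro power_decreasing) auto
    with \<open>a ^ n < 1 - a\<close> show "\<epsilon> \<le> 1 - a" by simp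
  qed
  have "\<exists>G\<in>creation_algebra. evaluation 0 G = 1 \<and> (\<forall>\<xi>. blinfun_apply G \<xi> - a *\<^sub>R blinfun_apply u (blinfun_apply G \<xi>)
      = \<xi> - a ^ Suc n *\<^sub>R (blinfun_apply u ^^ Suc n) \<xi>)" for n
  proof (induction n)
    case 0
    show ?case
      by (rule bexI[of _ id_blinfun]) (simp_all add: evaluation_id creation_algebra.one)
  next
    case (Suc n)
    then obtain G where G: "G \<in> creation_algebra" "evaluation 0 G = 1"
      and eq: "\<And>\<xi>. blinfun_apply G \<xi> - a *\<^sub>R blinfun_apply u (blinfun_apply G \<xi>)
        = \<xi> - a ^ Suc n *\<^sub>R (blinfun_apply u ^^ Suc n) \<xi>" by blast
    let ?G = "id_blinfun + cscale_op (complex_of_real a) (u o\<^sub>L G)"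
    have app: "blinfun_apply ?G \<xi> = \<xi> + a *\<^sub>R blinfun_apply u (blinfun_apply G \<xi>)" for \<xi>
      by (simp add: blinfun.add_left cscale_fock_of_real)
    have "blinfun_apply ?G \<xi> - a *\<^sub>R blinfun_apply u (blinfun_apply ?G \<xi>)
        = \<xi> - a ^ Suc (Suc n) *\<^sub>R (blinfun_apply u ^^ Suc (Suc n)) \<xi>" for \<xi>
    proof -
      have "blinfun_apply ?G \<xi> - a *\<^sub>R blinfun_apply u (blinfun_apply ?G \<xi>)
          = \<xi> - a *\<^sub>R blinfun_apply u \<xi>
            + a *\<^sub>R blinfun_apply u (blinfun_apply G \<xi> - a *\<^sub>R blinfun_apply u (blinfun_apply G \<xi>))"
        unfolding app by (simp add: blinfun.add_right blinfun.diff_right blinfun.scaleR_right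
            scaleR_diff_right scaleR_add_right)
      also have "\<dots> = \<xi> - a ^ Suc (Suc n) *\<^sub>R (blinfun_apply u ^^ Suc (Suc n)) \<xi>"
        unfolding eq by (simp add: blinfun.diff_right blinfun.scaleR_right scaleR_diff_right)
      finally show ?thesis .
    qed
    moreover have "?G \<in> creation_algebra"
      by (intro creation_algebra.intros u G)
    moreover have "evaluation 0 ?G = 1"
      by (simp add: evaluation_add evaluation_cscale evaluation_id evaluation_mult u0
          creation_algebra_hardy[OF u])
    ultimately show ?case by blast
  qed
  then obtain G where G: "G \<in> creation_algebra" "evaluation 0 G = 1"
    and eq: "\<And>\<xi>. blinfun_apply G \<xi> - a *\<^sub>R blinfun_apply u (blinfun_apply G \<xi>)
      = \<xi> - \<epsilon> *\<^sub>R (blinfun_apply u ^^ Suc n) \<xi>" unfolding \<epsilon>_def by blast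
  define h where "h = cscale_op (complex_of_real a) id_blinfun + cscale_op (complex_of_real (-1)) u"
  define b where "b = cscale_op (complex_of_real (1 / (1 + \<epsilon>))) (h o\<^sub>L G)"
  have h: "h \<in> creation_algebra" unfolding h_def by (intro creation_algebra.intros u)
  have happ: "blinfun_apply h \<xi> = a *\<^sub>R \<xi> - blinfun_apply u \<xi>" for \<xi>
    unfolding h_def blinfun.add_left cscale_op_apply cscale_fock_of_real by simp
  have b: "b \<in> creation_algebra" unfolding b_def by (intro creation_algebra.intros h G)
  have "norm (blinfun_apply b \<xi>) \<le> norm \<xi>" for \<xi>
  proof -
    have "norm (blinfun_apply h (blinfun_apply G \<xi>))
        \<le> norm (blinfun_apply G \<xi> - a *\<^sub>R blinfun_apply u (blinfun_apply G \<xi>))"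
      unfolding happ using a row_operator_contraction[OF c, folded u_def]
      by (intro norm_blaschke_numerator_le) auto
    also have "\<dots> \<le> norm \<xi> + \<epsilon> * norm \<xi>"
      unfolding eq using \<epsilon>(1) row_operator_funpow_contraction[OF c, of "Suc n" \<xi>, folded u_def]
      by (intro order_trans[OF norm_triangle_ineq4] add_mono) (auto intro: mult_left_mono)
    finally have "norm (blinfun_apply h (blinfun_apply G \<xi>)) \<le> (1 + \<epsilon>) * norm \<xi>"
      by (simp add: algebra_simps)
    then show ?thesis
      unfolding b_def cscale_op_apply cscale_fock_of_real using \<epsilon> by (simp add: field_simps)
  qed
  moreover have "evaluation l b = 0"
    using l ul unfolding b_def
    by (simp add: evaluation_cscale evaluation_mult creation_algebra_hardy[OF h])
       (simp add: h_def evaluation_add evaluation_cscale evaluation_id)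
  moreover have "evaluation 0 b = complex_of_real (a / (1 + \<epsilon>))"
    unfolding b_def using G u0
    by (simp add: evaluation_cscale evaluation_mult creation_algebra_hardy[OF h])
       (simp add: h_def evaluation_add evaluation_cscale evaluation_id)
  moreover have "0 \<le> a / (1 + \<epsilon>)" "a / (1 + \<epsilon>) \<le> 1" using a \<epsilon> by (auto simp: field_simps)
  moreover have "1 - a / (1 + \<epsilon>) \<le> 2 * (1 - norm l)"
  proof -
    have "1 - a / (1 + \<epsilon>) = (1 + \<epsilon> - a) / (1 + \<epsilon>)" using \<epsilon> by (simp add: field_simps)
    also have "\<dots> \<le> (1 + \<epsilon> - a) / 1" using a \<epsilon> by (intro divide_left_mono) auto
    also have "\<dots> \<le> 2 * (1 - norm l)" using \<epsilon> unfolding a_def by simp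
    finally show ?thesis .
  qed
  ultimately show ?thesis using b by blast
qed

section \<open>Infinite products of contractions\<close>

fun op_product :: "(nat \<Rightarrow> ('n fock \<Rightarrow>\<^sub>L 'n fock)) \<Rightarrow> nat \<Rightarrow> ('n fock \<Rightarrow>\<^sub>L 'n fock)"
  where
    "op_product b 0 = id_blinfun"
  | "op_product b (Suc m) = op_product b m o\<^sub>L b m"

lemma op_product_in_algebra: "(\<And>j. b j \<in> creation_algebra) \<Longrightarrow> op_product b m \<in> creation_algebra"
  by (induction m) (auto intro: creation_algebra.intros)

lemma op_product_contraction:
  assumes "\<And>j \<xi>. norm (blinfun_apply (b j) \<xi>) \<le> norm \<xi>"
  shows "norm (blinfun_apply (op_product b m) \<xi>) \<le> norm \<xi>"
  using assms by (induction m arbitrary: \<xi>) (auto intro: order_trans)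

lemma op_product_add: "op_product b (m + p) = op_product b m o\<^sub>L op_product (\<lambda>j. b (j + m)) p"
  by (induction p) (auto intro!: blinfun_eqI simp: add.commute)

lemma evaluation_op_product:
  assumes "norm z < 1" "\<And>j. b j \<in> creation_algebra"
  shows "evaluation z (op_product b m) = (\<Prod>j<m. evaluation z (b j))"
  by (induction m)
     (simp_all add: assms evaluation_id evaluation_mult creation_algebra_hardy op_product_in_algebra)

text \<open>
  A contraction \<open>Q\<close> moves the vacuum by at most \<open>\<surd>(2 - 2 Re \<langle>Q1, 1\<rangle>)\<close>, and the vacuum expectation
  of a product is the product of the vacuum expectations, which are evaluations at the origin.
\<close>

lemma op_product_vacuum_displacement:
  fixes b :: "nat \<Rightarrow> ('n::finite fock \<Rightarrow>\<^sub>L 'n fock)"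
  assumes alg: "\<And>j. b j \<in> creation_algebra"
    and contr: "\<And>j \<xi>. norm (blinfun_apply (b j) \<xi>) \<le> norm \<xi>"
    and \<beta>: "\<And>j. evaluation 0 (b j) = complex_of_real (\<beta> j)" "\<And>j. 0 \<le> \<beta> j" "\<And>j. \<beta> j \<le> 1"
  shows "(norm (blinfun_apply (op_product b p) vacuum - vacuum))\<^sup>2 \<le> 2 * (\<Sum>j<p. 1 - \<beta> j)"
proof -
  let ?x = "blinfun_apply (op_product b p) vacuum"
  have "evaluation 0 (op_product b p) = complex_of_real (\<Prod>j<p. \<beta> j)"
    by (simp add: evaluation_op_product alg \<beta>)
  then have inner: "?x \<bullet> vacuum = (\<Prod>j<p. \<beta> j)"
    by (simp add: evaluation_def kernel_0 Re_cinner[symmetric] del: of_real_prod)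
  have "norm ?x \<le> 1" using op_product_contraction[of b p vacuum] contr by simp
  then have x: "(norm ?x)\<^sup>2 \<le> 1" by (simp add: power_le_one)
  have "(norm (?x - vacuum))\<^sup>2 = (norm ?x)\<^sup>2 - 2 * (?x \<bullet> vacuum) + (norm (vacuum :: 'n fock))\<^sup>2"
    unfolding power2_norm_eq_inner
    by (simp add: inner_diff_left inner_diff_right inner_commute[of vacuum ?x] del: dot_square_norm)
  also have "\<dots> \<le> 2 * (1 - (\<Prod>j<p. \<beta> j))"
    unfolding inner using x by simp
  also have "1 - (\<Prod>j<p. \<beta> j) \<le> (\<Sum>j<p. 1 - \<beta> j)"
    using Weierstrass_prod_ineq[of "{..<p}" "\<lambda>j. 1 - \<beta> j"] \<beta> by simp
  finally show ?thesis by simp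
qed

text \<open>
  The partial products are Cauchy on the vacuum by the previous estimate applied to blocks of factors;
  convergence everywhere then follows because elements of the Hardy algebra are convolutions.
\<close>

lemma infinite_product:
  fixes b :: "nat \<Rightarrow> ('n::finite fock \<Rightarrow>\<^sub>L 'n fock)"
  assumes alg: "\<And>j. b j \<in> creation_algebra"
    and contr: "\<And>j \<xi>. norm (blinfun_apply (b j) \<xi>) \<le> norm \<xi>"
    and \<beta>: "\<And>j. evaluation 0 (b j) = complex_of_real (\<beta> j)" "\<And>j. 0 \<le> \<beta> j" "\<And>j. \<beta> j \<le> 1"
    and sum: "summable (\<lambda>j. 1 - \<beta> j)"
  obtains T where "T \<in> hardy_set"
    "\<And>z. (\<lambda>m. evaluation z (op_product b m)) \<longlonglongrightarrow> evaluation z T"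
    "\<And>z. norm z < 1 \<Longrightarrow> cmod (evaluation z T - 1) \<le> sqrt (2 * (\<Sum>j. 1 - \<beta> j)) * norm (kernel z)"
proof -
  note cont = op_product_contraction[of b, OF contr]
  have "Cauchy (\<lambda>m. coeff_fock (blinfun_apply (op_product b m) vacuum) w)" for w
  proof (rule CauchyI')
    fix e :: real assume e: "e > 0"
    then have "e\<^sup>2 / 2 > 0" by simp
    then obtain N where N: "\<And>m n. m \<ge> N \<Longrightarrow> norm (\<Sum>j\<in>{m..<n}. 1 - \<beta> j) < e\<^sup>2 / 2"
      using sum unfolding summable_Cauchy by metis
    have "cmod (coeff_fock (blinfun_apply (op_product b m) vacuum) w
        - coeff_fock (blinfun_apply (op_product b n) vacuum) w) < e" if mn: "m \<ge> N" "m < n" for m n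
    proof -
      from mn obtain p where n: "n = m + p" using less_imp_add_positive by blast
      let ?x = "blinfun_apply (op_product (\<lambda>j. b (j + m)) p) vacuum"
      have "blinfun_apply (op_product b n) vacuum - blinfun_apply (op_product b m) vacuum
          = blinfun_apply (op_product b m) (?x - vacuum)"
        by (simp add: n op_product_add blinfun.diff_right)
      then have "norm (blinfun_apply (op_product b n) vacuum - blinfun_apply (op_product b m) vacuum)
          \<le> norm (?x - vacuum)"
        using cont by simp
      also have "\<dots> < e"
      proof (rule power_less_imp_less_base)
        have "(norm (?x - vacuum))\<^sup>2 \<le> 2 * (\<Sum>j<p. 1 - \<beta> (j + m))"
          by (rule op_product_vacuum_displacement) (simp_all add: alg contr \<beta>)
        also have "(\<Sum>j<p. 1 - \<beta> (j + m)) = (\<Sum>j\<in>{m..<n}. 1 - \<beta> j)"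
          using sum.shift_bounds_nat_ivl[of "\<lambda>j. 1 - \<beta> j" 0 m p]
          by (simp add: n lessThan_atLeast0 add.commute)
        finally show "(norm (?x - vacuum))\<^sup>2 < e\<^sup>2" using N[OF mn(1), of n] by simp
      qed (use e in simp)
      finally show ?thesis
        using norm_coeff_le[of "blinfun_apply (op_product b n) vacuum - blinfun_apply (op_product b m) vacuum" w]
        by (simp add: norm_minus_commute)
    qed
    then show "\<exists>N. \<forall>m\<ge>N. \<forall>n>m. dist (coeff_fock (blinfun_apply (op_product b m) vacuum) w)
        (coeff_fock (blinfun_apply (op_product b n) vacuum) w) < e"
      unfolding dist_norm by blast
  qed
  then have "convergent (\<lambda>m. coeff_fock (blinfun_apply (op_product b m) vacuum) w)" for w
    by (rule Cauchy_convergent)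
  with hardy_contractive_limit[of "op_product b"] cont
  obtain T where T: "T \<in> hardy_set" and lim:
    "\<And>\<xi> \<eta>. (\<lambda>m. cinner_fock (blinfun_apply (op_product b m) \<xi>) \<eta>) \<longlonglongrightarrow> cinner_fock (blinfun_apply T \<xi>) \<eta>"
    using creation_algebra_hardy[OF op_product_in_algebra[of b, OF alg]] by metis
  have ev: "(\<lambda>m. evaluation z (op_product b m)) \<longlonglongrightarrow> evaluation z T" for z
    unfolding evaluation_def by (rule lim)
  have "cmod (evaluation z T - 1) \<le> sqrt (2 * (\<Sum>j. 1 - \<beta> j)) * norm (kernel z)" if z: "norm z < 1" for z
  proof (rule tendsto_upperbound)
    show "(\<lambda>m. cmod (evaluation z (op_product b m) - 1)) \<longlonglongrightarrow> cmod (evaluation z T - 1)"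
      by (intro tendsto_intros ev)
    have "cmod (evaluation z (op_product b m) - 1) \<le> sqrt (2 * (\<Sum>j. 1 - \<beta> j)) * norm (kernel z)" for m
    proof -
      let ?x = "blinfun_apply (op_product b m) vacuum"
      have "evaluation z (op_product b m) - 1 = cinner_fock (?x - vacuum) (kernel z)"
        by (simp add: evaluation_def cinner_diff_left cinner_vacuum_kernel z)
      then have "cmod (evaluation z (op_product b m) - 1) \<le> norm (?x - vacuum) * norm (kernel z)"
        using cinner_Cauchy_Schwarz by simp
      also have "norm (?x - vacuum) \<le> sqrt (2 * (\<Sum>j<m. 1 - \<beta> j))"
        by (rule real_le_rsqrt, rule op_product_vacuum_displacement) (simp_all add: alg contr \<beta>)
      also have "sqrt (2 * (\<Sum>j<m. 1 - \<beta> j)) \<le> sqrt (2 * (\<Sum>j. 1 - \<beta> j))"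
        using sum_le_suminf[OF sum, of "{..<m}"] \<beta> by simp
      finally show ?thesis by (simp add: mult_right_mono)
    qed
    then show "\<forall>\<^sub>F m in sequentially. cmod (evaluation z (op_product b m) - 1)
        \<le> sqrt (2 * (\<Sum>j. 1 - \<beta> j)) * norm (kernel z)" by simp
  qed simp
  with T ev that show ?thesis by blast
qed

section \<open>Separating a point from a Blaschke sequence\<close>

text \<open>
  For finitely many points, multiply affine functions of a coordinate in which \<open>z\<close> differs from the
  point to be annihilated.
\<close>

lemma finite_separation:
  fixes l :: "nat \<Rightarrow> complex ^ 'n::finite"
  assumes l: "\<And>j. norm (l j) < 1" and z: "norm z < 1" "z \<notin> range l"
  shows "\<exists>P\<in>creation_algebra. (\<forall>j<k. evaluation (l j) P = 0) \<and> evaluation z P \<noteq> 0"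
proof (induction k)
  case 0
  show ?case by (rule bexI[of _ id_blinfun]) (simp_all add: evaluation_id z creation_algebra.one)
next
  case (Suc k)
  then obtain P where P: "P \<in> creation_algebra" "\<And>j. j < k \<Longrightarrow> evaluation (l j) P = 0"
    "evaluation z P \<noteq> 0" by blast
  have "l k \<noteq> z" using z by auto
  then obtain i where i: "l k $ i \<noteq> z $ i" by (auto simp: vec_eq_iff)
  let ?h = "creation i + cscale_op (- (l k $ i)) id_blinfun"
  have h: "?h \<in> creation_algebra" by (intro creation_algebra.intros)
  have ev: "evaluation y (?h o\<^sub>L P) = (y $ i - l k $ i) * evaluation y P" if "norm y < 1" for y
    unfolding evaluation_mult[OF that creation_algebra_hardy[OF h]]
    by (simp add: evaluation_add evaluation_cscale evaluation_creation evaluation_id that)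
  show ?case
  proof (intro bexI conjI allI impI)
    show "?h o\<^sub>L P \<in> creation_algebra" by (rule creation_algebra.mult[OF h P(1)])
    show "evaluation z (?h o\<^sub>L P) \<noteq> 0" using ev[OF z(1)] i P by auto
    show "evaluation (l j) (?h o\<^sub>L P) = 0" if "j < Suc k" for j
      unfolding ev[OF l] using P(2) that by (cases "j = k") auto
  qed
qed

text \<open>
  A Blaschke factor for \<open>\<lambda>\<^sub>j\<close> may vanish at \<open>z\<close> as well. The
  product over a tail of the sequence is nevertheless within distance less than \<open>1\<close> of \<open>1\<close> at \<open>z\<close>,
  so no factor of the tail vanishes there, and the finitely many points before the tail are
  annihilated by affine factors instead.
\<close>

lemma blaschke_separation:
  fixes l :: "nat \<Rightarrow> complex ^ 'n::finite"
  assumes l: "\<And>j. norm (l j) < 1" and sum: "summable (\<lambda>j. 1 - norm (l j))"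
    and z: "norm z < 1" "z \<notin> range l"
  obtains \<phi> where "\<phi> \<in> hardy_set" "\<And>j. evaluation (l j) \<phi> = 0" "evaluation z \<phi> \<noteq> 0"
proof -
  from polynomial_blaschke_factor[OF l] obtain b \<beta>
    where alg: "\<And>j. b j \<in> creation_algebra"
      and contr: "\<And>j \<xi>. norm (blinfun_apply (b j) \<xi>) \<le> norm \<xi>"
      and zero: "\<And>j. evaluation (l j) (b j) = 0"
      and \<beta>: "\<And>j. evaluation 0 (b j) = complex_of_real (\<beta> j)" "\<And>j. 0 \<le> \<beta> j" "\<And>j. \<beta> j \<le> 1"
      and le: "\<And>j. 1 - \<beta> j \<le> 2 * (1 - norm (l j))" by metis
  have sum\<beta>: "summable (\<lambda>j. 1 - \<beta> j)"
    by (rule summable_comparison_test'[OF summable_mult[OF sum, of 2], of 0]) (use \<beta> le in auto)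
  define K where "K = norm (kernel z)"
  \<comment> \<open>A tail sum \<open>t\<close> below this bound gives \<open>2 t K\<^sup>2 < 1\<close>, which keeps the product away from \<open>0\<close> at \<open>z\<close>.\<close>
  have "1 / (2 * (K\<^sup>2 + 1)) > 0"
    by (intro divide_pos_pos mult_pos_pos add_nonneg_pos) auto
  from suminf_exist_split[OF this sum\<beta>]
  obtain k where "norm (\<Sum>j. 1 - \<beta> (j + k)) < 1 / (2 * (K\<^sup>2 + 1))" by blast
  moreover define t where "t = (\<Sum>j. 1 - \<beta> (j + k))"
  ultimately have t: "t < 1 / (2 * (K\<^sup>2 + 1))" by simp
  have sumk: "summable (\<lambda>j. 1 - \<beta> (j + k))" using sum\<beta> by (rule summable_ignore_initial_segment)
  have "t \<ge> 0" unfolding t_def by (rule suminf_nonneg[OF sumk]) (simp add: \<beta>)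
  obtain T where T: "T \<in> hardy_set"
    and lim: "\<And>z. (\<lambda>m. evaluation z (op_product (\<lambda>j. b (j + k)) m)) \<longlonglongrightarrow> evaluation z T"
    and near: "\<And>z. norm z < 1 \<Longrightarrow> cmod (evaluation z T - 1) \<le> sqrt (2 * t) * norm (kernel z)"
    using infinite_product[of "\<lambda>j. b (j + k)" "\<lambda>j. \<beta> (j + k)"] alg contr \<beta> sumk
    unfolding t_def by blast
  have "sqrt (2 * t) * K < 1"
  proof (rule power_less_imp_less_base)
    have "(sqrt (2 * t) * K)\<^sup>2 = 2 * t * K\<^sup>2" using \<open>t \<ge> 0\<close> by (simp add: power_mult_distrib)
    also have "\<dots> \<le> t * (2 * (K\<^sup>2 + 1))" using \<open>t \<ge> 0\<close> by (simp add: algebra_simps)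
    also have "\<dots> < 1"
      using t by (subst (asm) pos_less_divide_eq) (auto intro!: mult_pos_pos add_nonneg_pos)
    finally show "(sqrt (2 * t) * K)\<^sup>2 < 1\<^sup>2" by simp
  qed simp
  with near[OF z(1)] have Tz: "evaluation z T \<noteq> 0" by (auto simp: K_def)
  obtain P where P: "P \<in> creation_algebra" "\<And>j. j < k \<Longrightarrow> evaluation (l j) P = 0"
    "evaluation z P \<noteq> 0" using finite_separation[OF l z] by blast
  note mult = evaluation_mult[OF _ creation_algebra_hardy[OF P(1)]]
  show thesis
  proof
    show "P o\<^sub>L T \<in> hardy_set" by (rule hardy_mult[OF creation_algebra_hardy[OF P(1)] T])
    show "evaluation z (P o\<^sub>L T) \<noteq> 0" using mult[OF z(1)] P(3) Tz by simp
    show "evaluation (l j) (P o\<^sub>L T) = 0" for j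
    proof (cases "j < k")
      case True
      then show ?thesis using mult[OF l] P(2) by simp
    next
      case False
      have "evaluation (l j) (op_product (\<lambda>j. b (j + k)) m) = 0" if "m > j - k" for m
        unfolding evaluation_op_product[OF l alg]
        by (rule prod_zero) (use that False zero[of j] in \<open>auto intro!: bexI[of _ "j - k"]\<close>)
      then have "\<forall>\<^sub>F m in sequentially. evaluation (l j) (op_product (\<lambda>j. b (j + k)) m) = 0"
        by (auto simp: eventually_at_top_dense)
      then have "(\<lambda>m. evaluation (l j) (op_product (\<lambda>j. b (j + k)) m)) \<longlonglongrightarrow> 0"
        by (rule tendsto_eventually)
      with lim have "evaluation (l j) T = 0" using LIMSEQ_unique by blast
      then show ?thesis using mult[OF l] by simp
    qed
  qed
qed

section \<open>Characters of the Hardy algebra\<close>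

lemma hardy_simps [simp]:
  "carrier hardy = hardy_set" "S \<otimes>\<^bsub>hardy\<^esub> T = S o\<^sub>L T" "S \<oplus>\<^bsub>hardy\<^esub> T = S + T"
  "\<one>\<^bsub>hardy\<^esub> = id_blinfun" "\<zero>\<^bsub>hardy\<^esub> = 0" "c \<odot>\<^bsub>hardy\<^esub> T = cscale_op c T"
  by (simp_all add: hardy_def)

lemma topspace_hardy_weakstar [simp]: "topspace hardy_weakstar = hardy_set"
  using hardy_fock_ops by (auto simp: hardy_weakstar_def topspace_wot)

lemma continuous_map_hardy_evaluation: "continuous_map hardy_weakstar euclidean (evaluation z)"
  unfolding hardy_weakstar_def
  by (rule continuous_map_from_subtopology) (rule continuous_map_evaluation)

lemma cscale_op_neg_one: "cscale_op (- 1) T = - T"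
  by (rule blinfun_eqI, rule fock_eqI) (simp add: blinfun.minus_left)

lemma cscale_op_zero: "cscale_op 0 T = 0"
  by (rule blinfun_eqI, rule fock_eqI) simp

lemma hardy_uminus: "T \<in> hardy_set \<Longrightarrow> - T \<in> hardy_set"
  using hardy_cscale[of T "- 1"] by (simp add: cscale_op_neg_one)

lemma hardy_diff: "S \<in> hardy_set \<Longrightarrow> T \<in> hardy_set \<Longrightarrow> S - T \<in> hardy_set"
  using hardy_add[of S "- T"] by (simp add: hardy_uminus)

lemma hardy_id: "id_blinfun \<in> hardy_set"
  by (rule creation_algebra_hardy) (rule creation_algebra.one)

lemma hardy_creation: "creation i \<in> hardy_set"
  by (rule creation_algebra_hardy) (rule creation_algebra.creation)

lemma hardy_zero: "0 \<in> hardy_set"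
  using hardy_cscale[OF hardy_id, of 0] by (simp add: cscale_op_zero)

lemma evaluation_diff: "evaluation z (S - T) = evaluation z S - evaluation z T"
  by (simp add: evaluation_def blinfun.diff_left cinner_diff_left)

lemma hardy_characterD:
  assumes "\<psi> \<in> characters hardy hardy_weakstar"
  shows "S \<in> hardy_set \<Longrightarrow> T \<in> hardy_set \<Longrightarrow> \<psi> (S + T) = \<psi> S + \<psi> T"
    and "S \<in> hardy_set \<Longrightarrow> T \<in> hardy_set \<Longrightarrow> \<psi> (S o\<^sub>L T) = \<psi> S * \<psi> T"
    and "\<psi> id_blinfun = 1"
    and "T \<in> hardy_set \<Longrightarrow> \<psi> (cscale_op c T) = c * \<psi> T"
    and "continuous_map hardy_weakstar euclidean \<psi>"
  using assms by (auto simp: characters_def ring_hom_def ring_of_type_algebra_def)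

lemma evaluation_character:
  assumes z: "norm z < 1"
  shows "restrict (evaluation z) hardy_set \<in> characters hardy hardy_weakstar"
proof -
  have "continuous_map hardy_weakstar euclidean (restrict (evaluation z) hardy_set)"
    by (rule continuous_map_eq[OF continuous_map_hardy_evaluation]) simp
  then show ?thesis
    by (auto simp: characters_def ring_hom_def ring_of_type_algebra_def hardy_add hardy_mult hardy_id
        hardy_cscale evaluation_add evaluation_mult evaluation_id evaluation_cscale z)
qed

text \<open>Uniqueness of \<open>\<pi>\<^sub>z\<close>: a continuous character is determined by its values on the generators.\<close>

lemma hardy_character_eqI:
  assumes \<psi>: "\<psi> \<in> characters hardy hardy_weakstar" and \<psi>': "\<psi>' \<in> characters hardy hardy_weakstar"
    and eq: "\<And>j. \<psi> (creation j) = \<psi>' (creation j)"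
  shows "\<psi> = \<psi>'"
proof -
  note D = hardy_characterD[OF \<psi>] and D' = hardy_characterD[OF \<psi>']
  have alg: "\<psi> T = \<psi>' T" if "T \<in> creation_algebra" for T
    using that by induction (simp_all add: D D' eq creation_algebra_hardy)
  have "hardy_weakstar closure_of creation_algebra = hardy_set"
    unfolding hardy_weakstar_def closure_of_subtopology
    by (subst Int_absorb1) (auto simp: creation_algebra_hardy hardy_set_def[symmetric])
  then have "\<psi> T = \<psi>' T" if "T \<in> hardy_set" for T
    by (intro forall_in_closure_of_eq[OF _ _ D(5) D'(5) alg]) (use that in auto)
  moreover have "\<psi> \<in> extensional hardy_set" "\<psi>' \<in> extensional hardy_set"
    using \<psi> \<psi>' by (auto simp: characters_def)
  ultimately show ?thesis by (metis extensionalityI)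
qed

lemma point_eval_eq_evaluation:
  assumes "norm z < 1" "T \<in> hardy_set"
  shows "point_eval z T = evaluation z T"
proof -
  have "point_eval z = restrict (evaluation z) hardy_set"
    unfolding point_eval_def
  proof (rule the_equality)
    show "restrict (evaluation z) hardy_set \<in> characters hardy hardy_weakstar \<and>
        (\<forall>j. restrict (evaluation z) hardy_set (creation j) = z $ j)"
      using assms by (simp add: evaluation_character hardy_creation evaluation_creation)
    fix \<psi> assume "\<psi> \<in> characters hardy hardy_weakstar \<and> (\<forall>j. \<psi> (creation j) = z $ j)"
    then show "\<psi> = restrict (evaluation z) hardy_set"
      using assms by (intro hardy_character_eqI evaluation_character)
        (simp_all add: hardy_creation evaluation_creation)
  qed
  with assms show ?thesis by simp
qed

text \<open>
  If \<open>z\<^sub>j = \<psi>(S\<^sub>j)\<close> had norm at least \<open>1\<close>, some row contraction \<open>u\<close> would satisfy \<open>\<psi>(u) = 1\<close>, hence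
  \<open>\<psi>(u\<^sup>k) = 1\<close> for all \<open>k\<close>; but \<open>u\<^sup>k\<close> raises the length of words by \<open>k\<close> and so tends to \<open>0\<close> in the
  weak operator topology.
\<close>

lemma hardy_character_in_ball:
  assumes \<psi>: "\<psi> \<in> characters hardy hardy_weakstar"
  shows "norm (\<chi> j. \<psi> (creation j)) < 1"
proof (rule ccontr)
  define z where "z = (\<chi> j. \<psi> (creation j))"
  assume "\<not> norm (\<chi> j. \<psi> (creation j)) < 1"
  then have z: "norm z \<ge> 1" by (simp add: z_def)
  note D = hardy_characterD[OF \<psi>]
  define c where "c i = cnj (z $ i) / complex_of_real ((norm z)\<^sup>2)" for i
  define u where "u = row_operator c"
  have u: "u \<in> creation_algebra" by (simp add: u_def row_operator_in_algebra)
  have \<psi>0: "\<psi> 0 = 0" using D(4)[OF hardy_id, of 0] by (simp add: cscale_op_zero)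
  have "(\<Sum>i\<in>I. cscale_op (c i) (creation i)) \<in> hardy_set \<and>
      \<psi> (\<Sum>i\<in>I. cscale_op (c i) (creation i)) = (\<Sum>i\<in>I. c i * z $ i)" if "finite I" for I
    using that
  proof induction
    case empty
    then show ?case by (simp add: \<psi>0 hardy_zero)
  next
    case (insert i I)
    then show ?case by (simp add: D hardy_add hardy_cscale hardy_creation z_def)
  qed
  then have "\<psi> u = (\<Sum>i\<in>UNIV. c i * z $ i)" by (simp add: u_def row_operator_def)
  also have "\<dots> = (\<Sum>i\<in>UNIV. complex_of_real ((cmod (z $ i))\<^sup>2)) / complex_of_real ((norm z)\<^sup>2)"
    unfolding c_def sum_divide_distrib
    by (rule sum.cong) (simp_all add: complex_norm_square mult.commute del: of_real_power)
  also have "\<dots> = 1"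
    using z by (simp only: of_real_sum[symmetric] norm_vec_complex[symmetric]) auto
  finally have \<psi>u: "\<psi> u = 1" .
  have "(\<Sum>i\<in>UNIV. (cmod (c i))\<^sup>2) = (\<Sum>i\<in>UNIV. (cmod (z $ i))\<^sup>2) / ((norm z)\<^sup>2)\<^sup>2"
    by (simp add: c_def norm_divide power_divide sum_divide_distrib norm_power)
  also have "\<dots> = 1 / (norm z)\<^sup>2"
    using z unfolding norm_vec_complex[symmetric] by (simp add: field_simps power2_eq_square)
  also have "\<dots> \<le> 1" using one_le_power[OF z, of 2] z by (simp add: divide_le_eq)
  finally have c: "(\<Sum>i\<in>UNIV. (cmod (c i))\<^sup>2) \<le> 1" .
  define U where "U = op_product (\<lambda>_. u)"
  have Uh: "U m \<in> hardy_set" for m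
    unfolding U_def by (intro creation_algebra_hardy op_product_in_algebra u)
  have Uapp: "blinfun_apply (U m) \<xi> = (blinfun_apply u ^^ m) \<xi>" for m \<xi>
    unfolding U_def by (induction m arbitrary: \<xi>) (simp_all add: funpow_swap1)
  have \<psi>U: "\<psi> (U m) = 1" for m
  proof (induction m)
    case 0
    then show ?case by (simp add: U_def D)
  next
    case (Suc m)
    then show ?case using Uh[of m] u by (simp add: U_def D \<psi>u creation_algebra_hardy)
  qed
  have "limitin wot U 0 sequentially"
  proof (rule limitin_wotI)
    fix \<xi> \<eta>
    have "(\<lambda>m. cinner_fock (blinfun_apply (U m) \<xi>) \<eta>) \<longlonglongrightarrow> cinner_fock 0 \<eta>"
    proof (rule bounded_coeff_tendsto_weak)
      show "norm (blinfun_apply (U m) \<xi>) \<le> norm \<xi>" for m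
        unfolding Uapp u_def by (rule row_operator_funpow_contraction[OF c])
      show "(\<lambda>m. coeff_fock (blinfun_apply (U m) \<xi>) w) \<longlonglongrightarrow> coeff_fock 0 w" for w
        by (rule tendsto_eventually)
           (auto simp: eventually_at_top_dense Uapp u_def coeff_row_operator_funpow
              intro!: exI[of _ "length w"])
    qed
    then show "(\<lambda>m. cinner_fock (blinfun_apply (U m) \<xi>) \<eta>) \<longlonglongrightarrow> cinner_fock (blinfun_apply 0 \<xi>) \<eta>"
      by simp
  qed (simp_all add: hardy_fock_ops hardy_zero Uh)
  then have "limitin hardy_weakstar U 0 sequentially"
    by (simp add: hardy_weakstar_def limitin_subtopology hardy_zero Uh)
  from continuous_map_limit[OF D(5) this] have "(\<lambda>m. \<psi> (U m)) \<longlonglongrightarrow> \<psi> 0" by (simp add: o_def)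
  then have "(\<lambda>m. 1 :: complex) \<longlonglongrightarrow> 0" by (simp add: \<psi>U \<psi>0)
  then show False by (simp add: LIMSEQ_const_iff)
qed

lemma hardy_character_is_evaluation:
  assumes "\<psi> \<in> characters hardy hardy_weakstar"
  obtains z where "norm z < 1" "\<And>T. T \<in> hardy_set \<Longrightarrow> \<psi> T = evaluation z T"
proof
  let ?z = "\<chi> j. \<psi> (creation j)"
  show z: "norm ?z < 1" by (rule hardy_character_in_ball[OF assms])
  have "\<psi> = restrict (evaluation ?z) hardy_set"
    using z by (intro hardy_character_eqI assms evaluation_character)
      (simp_all add: hardy_creation evaluation_creation)
  then show "\<psi> T = evaluation ?z T" if "T \<in> hardy_set" for T using that by (metis restrict_apply')
qed

section \<open>The quotient by the ideal of functions vanishing on a subset of the ball\<close>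

lemma hardy_ring: "ring hardy"
proof (rule ringI)
  show "abelian_group hardy"
  proof (rule abelian_groupI)
    fix T assume "T \<in> carrier hardy"
    then show "\<exists>y\<in>carrier hardy. y \<oplus>\<^bsub>hardy\<^esub> T = \<zero>\<^bsub>hardy\<^esub>"
      by (intro bexI[of _ "- T"]) (auto simp: hardy_uminus)
  qed (auto simp: hardy_add hardy_zero)
  show "monoid hardy"
    by (rule monoidI) (auto simp: hardy_mult hardy_id intro!: blinfun_eqI)
qed (auto intro!: blinfun_eqI simp: blinfun.add_left blinfun.add_right)

context
  fixes \<Delta> :: "(complex ^ 'n::finite) set"
  assumes ball: "\<Delta> \<subseteq> ball 0 1"
begin

lemma norm_less_one: "z \<in> \<Delta> \<Longrightarrow> norm z < 1"
  using ball by auto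

lemma null_ideal_iff: "\<phi> \<in> null_ideal \<Delta> \<longleftrightarrow> \<phi> \<in> hardy_set \<and> (\<forall>z\<in>\<Delta>. evaluation z \<phi> = 0)"
  by (auto simp: null_ideal_def point_eval_eq_evaluation norm_less_one)

lemma ideal_null_ideal: "ideal (null_ideal \<Delta>) hardy"
proof (rule idealI[OF hardy_ring])
  interpret ring hardy by (rule hardy_ring)
  have minus: "\<ominus>\<^bsub>hardy\<^esub> T = - T" if "T \<in> hardy_set" for T :: "'n fock \<Rightarrow>\<^sub>L 'n fock"
    using minus_equality[of "- T" T] that by (simp add: hardy_uminus)
  show "subgroup (null_ideal \<Delta>) (add_monoid hardy)"
  proof
    fix T assume "T \<in> null_ideal \<Delta>"
    then show "inv\<^bsub>add_monoid hardy\<^esub> T \<in> null_ideal \<Delta>"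
      using minus[of T] evaluation_diff[of _ 0 T]
      by (auto simp: null_ideal_iff a_inv_def hardy_uminus evaluation_zero)
  qed (auto simp: null_ideal_iff hardy_add hardy_zero evaluation_add evaluation_zero)
qed (auto simp: null_ideal_iff hardy_mult evaluation_mult norm_less_one)

abbreviation coset :: "('n fock \<Rightarrow>\<^sub>L 'n fock) \<Rightarrow> ('n fock \<Rightarrow>\<^sub>L 'n fock) set"
  where "coset \<phi> \<equiv> null_ideal \<Delta> +>\<^bsub>hardy\<^esub> \<phi>"

lemma coset_eq:
  assumes "T \<in> hardy_set"
  shows "coset T = {S \<in> hardy_set. \<forall>z\<in>\<Delta>. evaluation z S = evaluation z T}"
proof -
  have "S \<in> (\<lambda>n. n + T) ` null_ideal \<Delta>" if "S \<in> hardy_set" "\<forall>z\<in>\<Delta>. evaluation z S = evaluation z T" for S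
    using that assms by (intro image_eqI[of _ _ "S - T"]) (auto simp: null_ideal_iff hardy_diff evaluation_diff)
  then show ?thesis
    using assms by (auto simp: a_r_coset_def r_coset_def null_ideal_iff hardy_add evaluation_add)
qed

lemma coset_self: "T \<in> hardy_set \<Longrightarrow> T \<in> coset T"
  by (simp add: coset_eq)

lemma coset_eq_iff:
  assumes "S \<in> hardy_set" "T \<in> hardy_set"
  shows "coset S = coset T \<longleftrightarrow> (\<forall>z\<in>\<Delta>. evaluation z S = evaluation z T)"
  using coset_self[OF assms(1)] assms by (auto simp: coset_eq)

lemma quotient_simps:
  "carrier (hardy_quotient \<Delta>) = coset ` hardy_set"
  "\<one>\<^bsub>hardy_quotient \<Delta>\<^esub> = coset id_blinfun"
  "S \<in> hardy_set \<Longrightarrow> T \<in> hardy_set \<Longrightarrow> coset S \<oplus>\<^bsub>hardy_quotient \<Delta>\<^esub> coset T = coset (S + T)"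
  "S \<in> hardy_set \<Longrightarrow> T \<in> hardy_set \<Longrightarrow> coset S \<otimes>\<^bsub>hardy_quotient \<Delta>\<^esub> coset T = coset (S o\<^sub>L T)"
  "T \<in> hardy_set \<Longrightarrow> c \<odot>\<^bsub>hardy_quotient \<Delta>\<^esub> coset T = coset (cscale_op c T)"
proof -
  interpret ideal "null_ideal \<Delta>" hardy by (rule ideal_null_ideal)
  note defs = hardy_quotient_def quotient_algebra_def ring.defs module.defs FactRing_def
  show "carrier (hardy_quotient \<Delta>) = coset ` hardy_set"
    by (auto simp: defs A_RCOSETS_def')
  show "\<one>\<^bsub>hardy_quotient \<Delta>\<^esub> = coset id_blinfun"
    by (simp add: defs)
  show "coset S \<oplus>\<^bsub>hardy_quotient \<Delta>\<^esub> coset T = coset (S + T)" if "S \<in> hardy_set" "T \<in> hardy_set"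
    using a_rcos_sum[of S T] that by (simp add: defs)
  show "coset S \<otimes>\<^bsub>hardy_quotient \<Delta>\<^esub> coset T = coset (S o\<^sub>L T)" if "S \<in> hardy_set" "T \<in> hardy_set"
    using rcoset_mult_add[of S T] that by (simp add: defs)
  assume T: "T \<in> hardy_set"
  have "coset (cscale_op c S) = coset (cscale_op c T)" if "S \<in> coset T" for S
    using that T by (subst coset_eq_iff) (auto simp: coset_eq hardy_cscale evaluation_cscale)
  then have "(\<Union>S\<in>coset T. coset (cscale_op c S)) = (\<Union>S\<in>coset T. coset (cscale_op c T))"
    by (rule SUP_cong[OF refl])
  also have "\<dots> = coset (cscale_op c T)"
    using coset_self[OF T] by blast
  finally show "c \<odot>\<^bsub>hardy_quotient \<Delta>\<^esub> coset T = coset (cscale_op c T)"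
    by (simp add: defs)
qed

lemma topspace_quotient: "topspace (hardy_quotient_weakstar \<Delta>) = coset ` hardy_set"
proof -
  have "(\<lambda>_. 0) \<in> preannihilator (null_ideal \<Delta>)"
    by (simp add: preannihilator_def hardy_predual_def)
  then have "coset ` hardy_set \<in> {coset ` {\<phi> \<in> hardy_set. f \<phi> \<in> U} | f U.
      f \<in> preannihilator (null_ideal \<Delta>) \<and> open U}"
    by (intro CollectI exI[of _ "\<lambda>_. 0"] exI[of _ UNIV]) auto
  then show ?thesis by (auto simp: hardy_quotient_weakstar_def)
qed

text \<open>Functionals in the pre-annihilator descend to the quotient; this makes the generating sets of
  its weak* topology saturated, and hence the quotient map continuous.\<close>

lemma preannihilator_coset:
  assumes f: "f \<in> preannihilator (null_ideal \<Delta>)" and "S \<in> hardy_set" "T \<in> hardy_set" "coset S = coset T"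
  shows "f S = f T"
proof -
  have "S - T \<in> null_ideal \<Delta>"
    using assms by (simp add: coset_eq_iff null_ideal_iff hardy_diff evaluation_diff)
  then have "f (S - T) = 0" using f by (simp add: preannihilator_def)
  moreover have "f ((S - T) + T) = f (S - T) + f T"
    using f assms hardy_diff unfolding preannihilator_def hardy_predual_def by blast
  ultimately show ?thesis by simp
qed

lemma continuous_map_coset: "continuous_map hardy_weakstar (hardy_quotient_weakstar \<Delta>) coset"
  unfolding hardy_quotient_weakstar_def
proof (rule continuous_on_generated_topo)
  fix V assume "V \<in> {coset ` {\<phi> \<in> hardy_set. f \<phi> \<in> U} | f U. f \<in> preannihilator (null_ideal \<Delta>) \<and> open U}"
  then obtain f U where f: "f \<in> preannihilator (null_ideal \<Delta>)" and U: "open U"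
    and V: "V = coset ` {\<phi> \<in> hardy_set. f \<phi> \<in> U}" by blast
  have "f \<phi> \<in> U" if \<phi>: "\<phi> \<in> hardy_set" and "coset \<phi> \<in> V" for \<phi>
  proof -
    obtain \<phi>' where \<phi>': "\<phi>' \<in> hardy_set" "f \<phi>' \<in> U" "coset \<phi> = coset \<phi>'"
      using \<open>coset \<phi> \<in> V\<close> unfolding V by blast
    then show ?thesis using preannihilator_coset[OF f \<phi> \<phi>'(1,3)] by simp
  qed
  then have "coset -` V \<inter> topspace hardy_weakstar = {\<phi> \<in> topspace hardy_weakstar. f \<phi> \<in> U}"
    unfolding topspace_hardy_weakstar using V by blast
  also have "openin hardy_weakstar \<dots>"
    using f U by (intro openin_continuous_map_preimage) (auto simp: preannihilator_def hardy_predual_def)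
  finally show "openin hardy_weakstar (coset -` V \<inter> topspace hardy_weakstar)" .
next
  show "coset ` topspace hardy_weakstar \<subseteq> \<Union> {coset ` {\<phi> \<in> hardy_set. f \<phi> \<in> U} | f U.
      f \<in> preannihilator (null_ideal \<Delta>) \<and> open U}"
    using topspace_quotient
    unfolding hardy_quotient_weakstar_def topology_generated_by_topspace by simp
qed

section \<open>The spectrum of the quotient\<close>

lemma spectrum_character_evaluation:
  assumes \<psi>: "\<psi> \<in> weakstar_spectrum \<Delta>"
  obtains z where "norm z < 1" "\<And>\<phi>. \<phi> \<in> hardy_set \<Longrightarrow> \<psi> (coset \<phi>) = evaluation z \<phi>"
proof -
  let ?\<omega> = "restrict (\<psi> \<circ> coset) hardy_set"
  have hom: "\<psi> \<in> ring_hom (hardy_quotient \<Delta>) ring_of_type_algebra"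
    and scale: "\<And>c a. a \<in> carrier (hardy_quotient \<Delta>) \<Longrightarrow> \<psi> (c \<odot>\<^bsub>hardy_quotient \<Delta>\<^esub> a) = c * \<psi> a"
    and cont: "continuous_map (hardy_quotient_weakstar \<Delta>) euclidean \<psi>"
    using \<psi> by (auto simp: weakstar_spectrum_def characters_def)
  have mem: "coset T \<in> carrier (hardy_quotient \<Delta>)" if "T \<in> hardy_set" for T
    using that by (simp add: quotient_simps)
  have "\<psi> (coset (S + T)) = \<psi> (coset S) + \<psi> (coset T)"
    "\<psi> (coset (S o\<^sub>L T)) = \<psi> (coset S) * \<psi> (coset T)" if "S \<in> hardy_set" "T \<in> hardy_set" for S T
    using ring_hom_add[OF hom mem[OF that(1)] mem[OF that(2)]]
      ring_hom_mult[OF hom mem[OF that(1)] mem[OF that(2)]] that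
    by (simp_all add: quotient_simps ring_of_type_algebra_def)
  moreover have "\<psi> (coset id_blinfun) = 1"
    using ring_hom_one[OF hom] by (simp add: quotient_simps ring_of_type_algebra_def)
  moreover have "\<psi> (coset (cscale_op c T)) = c * \<psi> (coset T)" if "T \<in> hardy_set" for c T
    using scale[OF mem[OF that], of c] that by (simp add: quotient_simps)
  moreover have "continuous_map hardy_weakstar euclidean ?\<omega>"
    by (rule continuous_map_eq[OF continuous_map_compose[OF continuous_map_coset cont]]) simp
  ultimately have "?\<omega> \<in> characters hardy hardy_weakstar"
    by (auto simp: characters_def ring_hom_def ring_of_type_algebra_def hardy_add hardy_mult hardy_id
        hardy_cscale)
  then obtain z where z: "norm z < 1" "\<And>T. T \<in> hardy_set \<Longrightarrow> ?\<omega> T = evaluation z T"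
    by (rule hardy_character_is_evaluation) blast
  show ?thesis by (rule that[OF z(1)]) (use z(2) in \<open>simp add: restrict_def\<close>)
qed

lemma evaluation_spectrum_character:
  assumes z: "z \<in> \<Delta>"
  obtains \<psi> where "\<psi> \<in> weakstar_spectrum \<Delta>" "\<And>\<phi>. \<phi> \<in> hardy_set \<Longrightarrow> \<psi> (coset \<phi>) = evaluation z \<phi>"
proof -
  define \<psi> where "\<psi> = restrict (\<lambda>C. evaluation z (SOME \<phi>. \<phi> \<in> C)) (carrier (hardy_quotient \<Delta>))"
  \<comment> \<open>The chosen representative is immaterial: \<open>evaluation z\<close> is constant on every coset.\<close>
  have eq: "\<psi> (coset \<phi>) = evaluation z \<phi>" if "\<phi> \<in> hardy_set" for \<phi>
  proof -
    have "(SOME \<phi>'. \<phi>' \<in> coset \<phi>) \<in> coset \<phi>" using coset_self[OF that] by (rule someI)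
    then show ?thesis using z that by (simp add: \<psi>_def quotient_simps) (simp add: coset_eq)
  qed
  have ev: "evaluation z \<in> preannihilator (null_ideal \<Delta>)"
    using z by (simp add: preannihilator_def hardy_predual_def null_ideal_iff evaluation_add
        evaluation_cscale continuous_map_hardy_evaluation)
  have "continuous_map (hardy_quotient_weakstar \<Delta>) euclidean \<psi>"
    unfolding continuous_map_def
  proof (intro conjI allI impI)
    fix U :: "complex set" assume "openin euclidean U"
    then have U: "open U" by simp
    have "{C \<in> topspace (hardy_quotient_weakstar \<Delta>). \<psi> C \<in> U} = coset ` {\<phi> \<in> hardy_set. evaluation z \<phi> \<in> U}"
      unfolding topspace_quotient by (auto simp: eq)
    also have "openin (hardy_quotient_weakstar \<Delta>) \<dots>"
      unfolding hardy_quotient_weakstar_def by (rule topology_generated_by_Basis) (use ev U in blast)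
    finally show "openin (hardy_quotient_weakstar \<Delta>) {C \<in> topspace (hardy_quotient_weakstar \<Delta>). \<psi> C \<in> U}" .
  qed simp
  moreover have "\<psi> \<in> ring_hom (hardy_quotient \<Delta>) ring_of_type_algebra"
  proof (rule ring_hom_memI)
    fix C D assume "C \<in> carrier (hardy_quotient \<Delta>)" "D \<in> carrier (hardy_quotient \<Delta>)"
    then obtain S T where ST: "S \<in> hardy_set" "C = coset S" "T \<in> hardy_set" "D = coset T"
      by (auto simp: quotient_simps)
    show "\<psi> (C \<otimes>\<^bsub>hardy_quotient \<Delta>\<^esub> D) = \<psi> C \<otimes>\<^bsub>ring_of_type_algebra\<^esub> \<psi> D"
      unfolding ST(2,4) quotient_simps(4)[OF ST(1,3)] eq[OF ST(1)] eq[OF ST(3)] eq[OF hardy_mult[OF ST(1,3)]]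
      using z ST by (simp add: ring_of_type_algebra_def evaluation_mult norm_less_one)
    show "\<psi> (C \<oplus>\<^bsub>hardy_quotient \<Delta>\<^esub> D) = \<psi> C \<oplus>\<^bsub>ring_of_type_algebra\<^esub> \<psi> D"
      unfolding ST(2,4) quotient_simps(3)[OF ST(1,3)] eq[OF ST(1)] eq[OF ST(3)] eq[OF hardy_add[OF ST(1,3)]]
      by (simp add: ring_of_type_algebra_def evaluation_add)
  next
    show "\<psi> \<one>\<^bsub>hardy_quotient \<Delta>\<^esub> = \<one>\<^bsub>ring_of_type_algebra\<^esub>"
      unfolding quotient_simps(2) eq[OF hardy_id] using z
      by (simp add: ring_of_type_algebra_def evaluation_id norm_less_one)
  qed (simp add: ring_of_type_algebra_def)
  moreover have "\<psi> (c \<odot>\<^bsub>hardy_quotient \<Delta>\<^esub> C) = c * \<psi> C" if "C \<in> carrier (hardy_quotient \<Delta>)" for c C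
  proof -
    from that obtain T where T: "T \<in> hardy_set" "C = coset T" by (auto simp: quotient_simps)
    show ?thesis
      unfolding T(2) quotient_simps(5)[OF T(1)] eq[OF T(1)] eq[OF hardy_cscale[OF T(1)]]
      by (rule evaluation_cscale)
  qed
  moreover have "\<psi> \<in> extensional (carrier (hardy_quotient \<Delta>))" by (simp add: \<psi>_def)
  ultimately have "\<psi> \<in> weakstar_spectrum \<Delta>"
    unfolding weakstar_spectrum_def characters_def by simp
  from that[OF this eq] show thesis .
qed

lemma spectrum_point_eqI:
  assumes "norm z < 1" "\<And>\<phi>. \<phi> \<in> hardy_set \<Longrightarrow> \<psi> (coset \<phi>) = evaluation z \<phi>"
  shows "spectrum_point \<Delta> \<psi> = z"
  unfolding spectrum_point_def
proof (rule the_equality)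
  show "z \<in> ball 0 1 \<and> (\<forall>\<phi>\<in>hardy_set. \<psi> (coset \<phi>) = point_eval z \<phi>)"
    using assms by (simp add: point_eval_eq_evaluation)
  fix y assume "y \<in> ball 0 1 \<and> (\<forall>\<phi>\<in>hardy_set. \<psi> (coset \<phi>) = point_eval y \<phi>)"
  then have "evaluation y (creation i) = evaluation z (creation i)" "norm y < 1" for i
    using assms(2)[OF hardy_creation] by (auto simp: point_eval_eq_evaluation hardy_creation)
  then show "y = z" using assms(1) by (simp add: evaluation_creation vec_eq_iff)
qed

end

theorem theorem1p11:
  fixes l :: "nat \<Rightarrow> complex ^ 'n::finite" and \<Delta> :: "(complex ^ 'n) set"
  assumes "\<Delta> = range l"
    and "\<Delta> \<subseteq> ball 0 1"
    and "summable (\<lambda>j. 1 - norm (l j))"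
  shows "bij_betw (spectrum_point \<Delta>) (weakstar_spectrum \<Delta>) \<Delta>"
proof -
  note ball = assms(2)
  have l: "norm (l j) < 1" for j using assms(1,2) by (simp add: image_subset_iff)
  have char: "spectrum_point \<Delta> \<psi> \<in> \<Delta>
      \<and> (\<forall>\<phi>\<in>hardy_set. \<psi> (null_ideal \<Delta> +>\<^bsub>hardy\<^esub> \<phi>) = evaluation (spectrum_point \<Delta> \<psi>) \<phi>)"
    if \<psi>: "\<psi> \<in> weakstar_spectrum \<Delta>" for \<psi>
  proof -
    obtain z where z: "norm z < 1"
      and eq: "\<And>\<phi>. \<phi> \<in> hardy_set \<Longrightarrow> \<psi> (null_ideal \<Delta> +>\<^bsub>hardy\<^esub> \<phi>) = evaluation z \<phi>"
      by (rule spectrum_character_evaluation[OF ball \<psi>]) blast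
    have "z \<in> \<Delta>"
    proof (rule ccontr)
      assume "z \<notin> \<Delta>"
      then have "z \<notin> range l" by (simp add: assms(1))
      then obtain \<phi> where \<phi>: "\<phi> \<in> hardy_set" "\<And>j. evaluation (l j) \<phi> = 0" "evaluation z \<phi> \<noteq> 0"
        using blaschke_separation[OF l assms(3) z] by blast
      have "null_ideal \<Delta> +>\<^bsub>hardy\<^esub> \<phi> = null_ideal \<Delta> +>\<^bsub>hardy\<^esub> 0"
        using coset_eq_iff[OF ball \<phi>(1) hardy_zero] \<phi>(2) by (simp add: assms(1) evaluation_zero)
      then have "evaluation z \<phi> = evaluation z 0" using eq[OF \<phi>(1)] eq[OF hardy_zero] by simp
      with \<phi>(3) show False by (simp add: evaluation_zero)
    qed
    with spectrum_point_eqI[OF ball z, of \<psi>] eq show ?thesis by simp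
  qed
  show ?thesis
    unfolding bij_betw_def
  proof (intro conjI equalityI subsetI)
    show "inj_on (spectrum_point \<Delta>) (weakstar_spectrum \<Delta>)"
    proof (rule inj_onI)
      fix \<psi> \<psi>' assume \<psi>: "\<psi> \<in> weakstar_spectrum \<Delta>" and \<psi>': "\<psi>' \<in> weakstar_spectrum \<Delta>"
        and eq: "spectrum_point \<Delta> \<psi> = spectrum_point \<Delta> \<psi>'"
      show "\<psi> = \<psi>'"
      proof (rule extensionalityI)
        show "\<psi> \<in> extensional (carrier (hardy_quotient \<Delta>))" "\<psi>' \<in> extensional (carrier (hardy_quotient \<Delta>))"
          using \<psi> \<psi>' by (auto simp: weakstar_spectrum_def characters_def)
        fix C assume "C \<in> carrier (hardy_quotient \<Delta>)"
        then obtain \<phi> where "\<phi> \<in> hardy_set" "C = null_ideal \<Delta> +>\<^bsub>hardy\<^esub> \<phi>"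
          by (auto simp: quotient_simps[OF ball])
        then show "\<psi> C = \<psi>' C" using char[OF \<psi>] char[OF \<psi>'] eq by simp
      qed
    qed
  next
    fix z assume "z \<in> spectrum_point \<Delta> ` weakstar_spectrum \<Delta>"
    then show "z \<in> \<Delta>" using char by blast
  next
    fix z assume z: "z \<in> \<Delta>"
    obtain \<psi> where \<psi>: "\<psi> \<in> weakstar_spectrum \<Delta>"
      and eq: "\<And>\<phi>. \<phi> \<in> hardy_set \<Longrightarrow> \<psi> (null_ideal \<Delta> +>\<^bsub>hardy\<^esub> \<phi>) = evaluation z \<phi>"
      by (rule evaluation_spectrum_character[OF ball z]) blast
    have "spectrum_point \<Delta> \<psi> = z"
      using norm_less_one[OF ball z] eq by (rule spectrum_point_eqI[OF ball])
    with \<psi> show "z \<in> spectrum_point \<Delta> ` weakstar_spectrum \<Delta>" by blast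
  qed
qed

end
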